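(* For each $k\ge 1$ there exists a polynomial-time algorithm that, given a QCSP instance $(\phi,\mathbf{B})$ with $\mathbf{B}$ finite, decides whether $(\phi,\mathbf{B})$ is $k$-judge-consistent.
   Context: Multi-sorted relational first-order logic: structures $\mathbf{B}$ have sort universes $B_s$ and relations $R^{\mathbf{B}}$; variables have sorts $s(v)$; a "map $f:V\to B$" sends each $v\in V$ into $B_{s(v)}$; $f\upharpoonright U$ is restriction and $f[y\to b]$ the extension mapping $y$ to $b$. A qc-formula is built from atoms, conjunction (arbitrary finite arity), $\forall,\exists$; $\mathrm{free}(\phi)$ denotes free variables; a QCSP instance $(\phi,\mathbf{B})$ is a qc-sentence with a structure of the same signature. $I_\phi$ has one index per subformula occurrence of $\phi$, $\phi(i)$ is the subformula at $i$, parent/child refer to the syntax tree. A judgement is $(i,V,F)$ with $i\in I_\phi$, $V\subseteq\mathrm{free}(\phi(i))$, $F$ a set of maps $V\to B$ (exactly one map $\emptyset\to B$ exists); empty if $F=\emptyset$; width $|V|$. $F_1\Join F_2=\{f:U_1\cup U_2\to B: f\upharpoonright U_1\in F_1, f\upharpoonright U_2\in F_2\}$; for $y\in U$, $\epsilon_yF=\{f:U\setminus\{y\}\to B: f[y\to b]\in F$ for all $b\in B_{s(y)}\}$. A judgement proof is a finite sequence of judgements each of one of the types: (atom) $(i,\{v_1,\dots,v_k\},F)$ with $\phi(i)=R(v_1,\dots,v_k)$, $F=\{f:(f(v_1),\dots,f(v_k))\in R^{\mathbf{B}}\}$; (projection) $(i,U,F\upharpoonright U)$ from previous $(i,V,F)$,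 $U\subseteq V$; (join) $(i,U_1\cup U_2,F_1\Join F_2)$ from previous $(i,U_1,F_1),(i,U_2,F_2)$; (upward flow) $(i,V,F)$ from previous $(j,V,F)$, $i$ parent of $j$; ($\forall$-elimination) $(i,V\setminus\{y\},\epsilon_yF)$ from previous $(j,V,F)$, $y\in V$, $\phi(i)=\forall y\,\phi(j)$, $i$ parent of $j$; (downward flow) $(j,V,F)$ from previous $(i,V,F)$, $i$ parent of $j$. Width of a proof = maximum width of its judgements. $(\phi,\mathbf{B})$ is $k$-judge-consistent if no judgement proof of width at most $k$ contains an empty judgement. *)

theory Defs
  imports Main "HOL-Computational_Algebra.Polynomial"
begin

section \<open>Multi-sorted relational structures and qc-formulas\<close>

record ('s, 'r) signature =
  sorts :: "'s set"
  symbols :: "'r set"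
  arity :: "'r \<Rightarrow> 's list"

record ('s, 'r, 'b) struct = "('s, 'r) signature" +
  univ :: "'s \<Rightarrow> 'b set"
  rel :: "'r \<Rightarrow> 'b list set"

text \<open>A variable carries its sort: the sort of \<open>v\<close> is \<open>snd v\<close>.\<close>

type_synonym ('v, 's) var = "'v \<times> 's"

abbreviation sort_of :: "('v, 's) var \<Rightarrow> 's" where
  "sort_of \<equiv> snd"

datatype ('v, 's, 'r) qc =
    Atom 'r "('v, 's) var list"
  | Conj "('v, 's, 'r) qc list"
  | Forall "('v, 's) var" "('v, 's, 'r) qc"
  | Exists "('v, 's) var" "('v, 's, 'r) qc"

primrec free :: "('v, 's, 'r) qc \<Rightarrow> ('v, 's) var set" where
  "free (Atom R vs) = set vs"
| "free (Conj \<psi>s) = \<Union> (set (map free \<psi>s))"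
| "free (Forall y \<psi>) = free \<psi> - {y}"
| "free (Exists y \<psi>) = free \<psi> - {y}"

primrec well_sorted :: "('s, 'r, 'm) signature_scheme \<Rightarrow> ('v, 's, 'r) qc \<Rightarrow> bool" where
  "well_sorted \<Sigma> (Atom R vs) \<longleftrightarrow> R \<in> symbols \<Sigma> \<and> map sort_of vs = arity \<Sigma> R"
| "well_sorted \<Sigma> (Conj \<psi>s) \<longleftrightarrow> list_all id (map (well_sorted \<Sigma>) \<psi>s)"
| "well_sorted \<Sigma> (Forall y \<psi>) \<longleftrightarrow> sort_of y \<in> sorts \<Sigma> \<and> well_sorted \<Sigma> \<psi>"
| "well_sorted \<Sigma> (Exists y \<psi>) \<longleftrightarrow> sort_of y \<in> sorts \<Sigma> \<and> well_sorted \<Sigma> \<psi>"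

definition is_signature :: "('s, 'r, 'm) signature_scheme \<Rightarrow> bool" where
  "is_signature \<Sigma> \<longleftrightarrow> (\<forall>R\<in>symbols \<Sigma>. set (arity \<Sigma> R) \<subseteq> sorts \<Sigma>)"

definition is_struct :: "('s, 'r, 'b) struct \<Rightarrow> bool" where
  "is_struct B \<longleftrightarrow> is_signature B \<and>
     (\<forall>R\<in>symbols B. \<forall>bs\<in>rel B R. list_all2 (\<lambda>b s. b \<in> univ B s) bs (arity B R))"

definition finite_struct :: "('s, 'r, 'b) struct \<Rightarrow> bool" where
  "finite_struct B \<longleftrightarrow>
     finite (sorts B) \<and> finite (symbols B) \<and> (\<forall>s\<in>sorts B. finite (univ B s))"

definition qcsp_instance :: "('v, 's, 'r) qc \<Rightarrow> ('s, 'r, 'b) struct \<Rightarrow> bool" where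
  "qcsp_instance \<phi> B \<longleftrightarrow> is_struct B \<and> well_sorted B \<phi> \<and> free \<phi> = {}"

text \<open>Subformula occurrences are indexed by their paths from the root of the syntax tree.\<close>

type_synonym index = "nat list"

primrec children :: "('v, 's, 'r) qc \<Rightarrow> ('v, 's, 'r) qc list" where
  "children (Atom R vs) = []"
| "children (Conj \<psi>s) = \<psi>s"
| "children (Forall y \<psi>) = [\<psi>]"
| "children (Exists y \<psi>) = [\<psi>]"

fun subformula :: "('v, 's, 'r) qc \<Rightarrow> index \<Rightarrow> ('v, 's, 'r) qc option" where
  "subformula \<phi> [] = Some \<phi>"
| "subformula \<phi> (n # i) =
     (if n < length (children \<phi>) then subformula (children \<phi> ! n) i else None)"

definition indices :: "('v, 's, 'r) qc \<Rightarrow> index set" where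
  "indices \<phi> = {i. subformula \<phi> i \<noteq> None}"

definition subf :: "('v, 's, 'r) qc \<Rightarrow> index \<Rightarrow> ('v, 's, 'r) qc" where
  "subf \<phi> i = the (subformula \<phi> i)"

definition parent :: "('v, 's, 'r) qc \<Rightarrow> index \<Rightarrow> index \<Rightarrow> bool" where
  "parent \<phi> i j \<longleftrightarrow> i \<in> indices \<phi> \<and> j \<in> indices \<phi> \<and> (\<exists>n. j = i @ [n])"


section \<open>Judgements\<close>

text \<open>A map \<open>V \<rightarrow> B\<close> is a partial function with domain exactly \<open>V\<close>; in particular
  \<open>Map.empty\<close> is the only map on the empty set. Universes may be empty.\<close>

definition maps :: "('s, 'r, 'b) struct \<Rightarrow> ('v, 's) var set \<Rightarrow> (('v, 's) var \<rightharpoonup> 'b) set" where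
  "maps B V = {f. dom f = V \<and> (\<forall>v\<in>V. the (f v) \<in> univ B (sort_of v))}"

definition restrict_maps ::
  "(('v, 's) var \<rightharpoonup> 'b) set \<Rightarrow> ('v, 's) var set \<Rightarrow> (('v, 's) var \<rightharpoonup> 'b) set" where
  "restrict_maps F U = (\<lambda>f. f |` U) ` F"

definition join_maps ::
  "('s, 'r, 'b) struct \<Rightarrow> ('v, 's) var set \<Rightarrow> (('v, 's) var \<rightharpoonup> 'b) set \<Rightarrow>
   ('v, 's) var set \<Rightarrow> (('v, 's) var \<rightharpoonup> 'b) set \<Rightarrow> (('v, 's) var \<rightharpoonup> 'b) set" where
  "join_maps B U1 F1 U2 F2 = {f \<in> maps B (U1 \<union> U2). f |` U1 \<in> F1 \<and> f |` U2 \<in> F2}"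

definition eps_maps ::
  "('s, 'r, 'b) struct \<Rightarrow> ('v, 's) var \<Rightarrow> ('v, 's) var set \<Rightarrow>
   (('v, 's) var \<rightharpoonup> 'b) set \<Rightarrow> (('v, 's) var \<rightharpoonup> 'b) set" where
  "eps_maps B y U F = {f \<in> maps B (U - {y}). \<forall>b\<in>univ B (sort_of y). f(y \<mapsto> b) \<in> F}"

type_synonym ('v, 's, 'b) judgement =
  "index \<times> ('v, 's) var set \<times> (('v, 's) var \<rightharpoonup> 'b) set"

fun is_judgement ::
  "('v, 's, 'r) qc \<Rightarrow> ('s, 'r, 'b) struct \<Rightarrow> ('v, 's, 'b) judgement \<Rightarrow> bool" where
  "is_judgement \<phi> B (i, V, F) \<longleftrightarrow> i \<in> indices \<phi> \<and> V \<subseteq> free (subf \<phi> i) \<and> F \<subseteq> maps B V"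

fun empty_judgement :: "('v, 's, 'b) judgement \<Rightarrow> bool" where
  "empty_judgement (i, V, F) \<longleftrightarrow> F = {}"

fun width :: "('v, 's, 'b) judgement \<Rightarrow> nat" where
  "width (i, V, F) = card V"

text \<open>\<open>derives \<phi> B P J\<close>: \<open>J\<close> results from one rule application with premises in \<open>P\<close>.\<close>

inductive derives ::
  "('v, 's, 'r) qc \<Rightarrow> ('s, 'r, 'b) struct \<Rightarrow> ('v, 's, 'b) judgement set \<Rightarrow>
   ('v, 's, 'b) judgement \<Rightarrow> bool"
  for \<phi> :: "('v, 's, 'r) qc" and B :: "('s, 'r, 'b) struct"
    and P :: "('v, 's, 'b) judgement set" where
  atom: "\<lbrakk>i \<in> indices \<phi>; subf \<phi> i = Atom R vs\<rbrakk> \<Longrightarrow>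
    derives \<phi> B P (i, set vs, {f \<in> maps B (set vs). map (\<lambda>v. the (f v)) vs \<in> rel B R})"
| projection: "\<lbrakk>(i, V, F) \<in> P; U \<subseteq> V\<rbrakk> \<Longrightarrow> derives \<phi> B P (i, U, restrict_maps F U)"
| join: "\<lbrakk>(i, U1, F1) \<in> P; (i, U2, F2) \<in> P\<rbrakk> \<Longrightarrow>
    derives \<phi> B P (i, U1 \<union> U2, join_maps B U1 F1 U2 F2)"
| upward_flow: "\<lbrakk>(j, V, F) \<in> P; parent \<phi> i j\<rbrakk> \<Longrightarrow> derives \<phi> B P (i, V, F)"
| forall_elim: "\<lbrakk>(j, V, F) \<in> P; y \<in> V; subf \<phi> i = Forall y (subf \<phi> j); parent \<phi> i j\<rbrakk> \<Longrightarrow>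
    derives \<phi> B P (i, V - {y}, eps_maps B y V F)"
| downward_flow: "\<lbrakk>(i, V, F) \<in> P; parent \<phi> i j\<rbrakk> \<Longrightarrow> derives \<phi> B P (j, V, F)"

definition judgement_proof ::
  "('v, 's, 'r) qc \<Rightarrow> ('s, 'r, 'b) struct \<Rightarrow> ('v, 's, 'b) judgement list \<Rightarrow> bool" where
  "judgement_proof \<phi> B Js \<longleftrightarrow>
     (\<forall>n<length Js. is_judgement \<phi> B (Js ! n) \<and> derives \<phi> B (set (take n Js)) (Js ! n))"

definition proof_width :: "('v, 's, 'b) judgement list \<Rightarrow> nat" where
  "proof_width Js = Max (insert 0 (width ` set Js))"

definition judge_consistent :: "nat \<Rightarrow> ('v, 's, 'r) qc \<Rightarrow> ('s, 'r, 'b) struct \<Rightarrow> bool" where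
  "judge_consistent k \<phi> B \<longleftrightarrow>
     \<not> (\<exists>Js. judgement_proof \<phi> B Js \<and> proof_width Js \<le> k \<and> (\<exists>J\<in>set Js. empty_judgement J))"


section \<open>Algorithms and running time\<close>

text \<open>Algorithms are programs of a WHILE language over binary trees, in the style of N. D. Jones,
  \<^emph>\<open>Computability and Complexity from a Programming Perspective\<close>. Evaluating an expression is
  charged at least the size of the resulting tree, so reading, copying and comparing data is paid
  for in full. Hence a run of cost \<open>t\<close> can be simulated by a Turing machine in time polynomial
  in \<open>t\<close> and the input size, and conversely a Turing machine step is simulated with overhead
  polynomial in the tape length: polynomial time here is the usual polynomial time.\<close>

datatype tree = Leaf | Node tree tree

primrec tsize :: "tree \<Rightarrow> nat" where
  "tsize Leaf = 1"
| "tsize (Node l r) = tsize l + tsize r + 1"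

primrec left :: "tree \<Rightarrow> tree" where
  "left Leaf = Leaf"
| "left (Node l r) = l"

primrec right :: "tree \<Rightarrow> tree" where
  "right Leaf = Leaf"
| "right (Node l r) = r"

primrec enc_bool :: "bool \<Rightarrow> tree" where
  "enc_bool False = Leaf"
| "enc_bool True = Node Leaf Leaf"

datatype expr = Var nat | LeafE | NodeE expr expr | LeftE expr | RightE expr | EqE expr expr

type_synonym store = "nat \<Rightarrow> tree"

primrec eval :: "expr \<Rightarrow> store \<Rightarrow> tree" where
  "eval (Var x) s = s x"
| "eval LeafE s = Leaf"
| "eval (NodeE a b) s = Node (eval a s) (eval b s)"
| "eval (LeftE a) s = left (eval a s)"
| "eval (RightE a) s = right (eval a s)"
| "eval (EqE a b) s = enc_bool (eval a s = eval b s)"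

primrec eval_cost :: "expr \<Rightarrow> store \<Rightarrow> nat" where
  "eval_cost (Var x) s = tsize (s x)"
| "eval_cost LeafE s = 1"
| "eval_cost (NodeE a b) s = eval_cost a s + eval_cost b s + 1"
| "eval_cost (LeftE a) s = eval_cost a s + 1"
| "eval_cost (RightE a) s = eval_cost a s + 1"
| "eval_cost (EqE a b) s = eval_cost a s + eval_cost b s + 1"

datatype prog =
    Skip
  | Assign nat expr
  | Seq prog prog
  | If expr prog prog
  | While expr prog

text \<open>\<open>exec c s t s'\<close>: started in \<open>s\<close>, the program \<open>c\<close> halts in \<open>s'\<close> with running time \<open>t\<close>.
  A test succeeds if its value is not \<open>Leaf\<close>.\<close>

inductive exec :: "prog \<Rightarrow> store \<Rightarrow> nat \<Rightarrow> store \<Rightarrow> bool" where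
  Skip: "exec Skip s 1 s"
| Assign: "exec (Assign x e) s (eval_cost e s + 1) (s(x := eval e s))"
| Seq: "\<lbrakk>exec c s t s'; exec d s' t' s''\<rbrakk> \<Longrightarrow> exec (Seq c d) s (t + t') s''"
| IfTrue: "\<lbrakk>eval e s \<noteq> Leaf; exec c s t s'\<rbrakk> \<Longrightarrow>
    exec (If e c d) s (eval_cost e s + 1 + t) s'"
| IfFalse: "\<lbrakk>eval e s = Leaf; exec d s t s'\<rbrakk> \<Longrightarrow>
    exec (If e c d) s (eval_cost e s + 1 + t) s'"
| WhileFalse: "eval e s = Leaf \<Longrightarrow> exec (While e c) s (eval_cost e s + 1) s"
| WhileTrue: "\<lbrakk>eval e s \<noteq> Leaf; exec c s t s'; exec (While e c) s' t' s''\<rbrakk> \<Longrightarrow>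
    exec (While e c) s (eval_cost e s + 1 + t + t') s''"

lemma tsize_eval_le_cost: "tsize (eval e s) \<le> eval_cost e s"
proof -
  have pos: "1 \<le> tsize u" for u by (cases u) auto
  have l: "tsize (left u) \<le> tsize u" for u by (cases u) auto
  have r: "tsize (right u) \<le> tsize u" for u by (cases u) auto
  show ?thesis
  proof (induction e)
    case (LeftE e)
    then show ?case using l[of "eval e s"] by simp
  next
    case (RightE e)
    then show ?case using r[of "eval e s"] by simp
  next
    case (EqE a b)
    then show ?case using pos[of "eval a s"] pos[of "eval b s"]
      by (cases "eval a s = eval b s") auto
  qed auto
qed

lemma exec_deterministic:
  assumes "exec c s t1 s1" and "exec c s t2 s2"
  shows "t1 = t2 \<and> s1 = s2"
  using assms
proof (induction arbitrary: t2 s2 rule: exec.induct)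
  case (Seq c s t s' d t' s'')
  from Seq.prems show ?case
    by cases (use Seq.IH in blast)
next
  case (WhileTrue e s c t s' t' s'')
  from WhileTrue.prems show ?case
    by cases (use WhileTrue.IH WhileTrue.hyps in blast)+
qed (erule exec.cases; fastforce)+

definition init_store :: "tree \<Rightarrow> store" where
  "init_store x = (\<lambda>_. Leaf)(0 := x)"

definition outputs_within :: "prog \<Rightarrow> tree \<Rightarrow> nat \<Rightarrow> tree \<Rightarrow> bool" where
  "outputs_within c x n z \<longleftrightarrow> (\<exists>t s. exec c (init_store x) t s \<and> t \<le> n \<and> s 0 = z)"


section \<open>Presentation of finite instances as input\<close>

text \<open>As input, all names (of variables, sorts, symbols and elements) are bit strings.\<close>

type_synonym name = "bool list"

definition enc_list :: "('a \<Rightarrow> tree) \<Rightarrow> 'a list \<Rightarrow> tree" where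
  "enc_list enc xs = foldr (\<lambda>x t. Node (enc x) t) xs Leaf"

definition enc_pair :: "('a \<Rightarrow> tree) \<Rightarrow> ('b \<Rightarrow> tree) \<Rightarrow> 'a \<times> 'b \<Rightarrow> tree" where
  "enc_pair enc1 enc2 p = Node (enc1 (fst p)) (enc2 (snd p))"

definition enc_name :: "name \<Rightarrow> tree" where
  "enc_name = enc_list enc_bool"

definition enc_var :: "(name, name) var \<Rightarrow> tree" where
  "enc_var = enc_pair enc_name enc_name"

definition enc_tag :: "bool \<Rightarrow> bool \<Rightarrow> tree" where
  "enc_tag p q = Node (enc_bool p) (enc_bool q)"

primrec enc_qc :: "(name, name, name) qc \<Rightarrow> tree" where
  "enc_qc (Atom R vs) = Node (enc_tag False False) (Node (enc_name R) (enc_list enc_var vs))"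
| "enc_qc (Conj \<psi>s) = Node (enc_tag False True) (enc_list id (map enc_qc \<psi>s))"
| "enc_qc (Forall y \<psi>) = Node (enc_tag True False) (Node (enc_var y) (enc_qc \<psi>))"
| "enc_qc (Exists y \<psi>) = Node (enc_tag True True) (Node (enc_var y) (enc_qc \<psi>))"

text \<open>A finite structure is presented by listing, in any order and without repetition, its sorts
  with their elements and its relation symbols with their arities and tuples.\<close>

type_synonym sort_table = "(name \<times> name list) list"
type_synonym symbol_table = "(name \<times> name list \<times> name list list) list"

definition lists_struct ::
  "sort_table \<Rightarrow> symbol_table \<Rightarrow> (name, name, name) struct \<Rightarrow> bool" where
  "lists_struct us rs B \<longleftrightarrow>
     distinct (map fst us) \<and> set (map fst us) = sorts B \<and>
     (\<forall>(s, bs)\<in>set us. distinct bs \<and> set bs = univ B s) \<and>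
     distinct (map fst rs) \<and> set (map fst rs) = symbols B \<and>
     (\<forall>(R, ss, ts)\<in>set rs. ss = arity B R \<and> distinct ts \<and> set ts = rel B R)"

definition encodes_instance ::
  "tree \<Rightarrow> (name, name, name) qc \<Rightarrow> (name, name, name) struct \<Rightarrow> bool" where
  "encodes_instance x \<phi> B \<longleftrightarrow> (\<exists>us rs. lists_struct us rs B \<and>
     x = Node (enc_qc \<phi>)
           (Node (enc_list (enc_pair enc_name (enc_list enc_name)) us)
                 (enc_list (enc_pair enc_name
                     (enc_pair (enc_list enc_name) (enc_list (enc_list enc_name)))) rs)))"

end

theory Submission
  imports Defs
begin

text \<open>By joining and projecting one variable at a time, a judgement proof of width \<open>k\<close> amounts to
  a least fixed point over two kinds of facts: \<open>available k \<phi> i V\<close> (some judgement on \<open>V\<close> is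
  derivable at \<open>i\<close>) and \<open>excluded k \<phi> B i f\<close> (some derivable judgement at \<open>i\<close> omits the map
  \<open>f\<close>). The instance is inconsistent iff the empty map is excluded at the root. Availability cannot
  be dropped: if a universe is empty, a judgement on all maps would already be an empty judgement.
  For fixed \<open>k\<close> there are polynomially many facts, and a round of rule applications is a formula
  with quantifiers bounded by lists that are computable in polynomial time, so as many rounds as
  there are facts reach the fixed point. Free variables enter the side conditions of the flow rules
  and are computed in the same fixed point.\<close>

section \<open>Polynomial time\<close>

definition poly_bounded :: "(tree \<Rightarrow> nat) \<Rightarrow> bool" where
  "poly_bounded f \<longleftrightarrow> (\<exists>p :: nat poly. \<forall>x. f x \<le> poly p (tsize x))"

lemma poly_mono_nat: "m \<le> n \<Longrightarrow> poly (p :: nat poly) m \<le> poly p n"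
  by (induction p) (auto intro!: add_mono mult_le_mono)

lemma poly_bounded_const: "poly_bounded (\<lambda>x. n)"
  unfolding poly_bounded_def by (rule exI[of _ "[:n:]"]) simp

lemma poly_bounded_tsize: "poly_bounded tsize"
  unfolding poly_bounded_def by (rule exI[of _ "[:0, 1:]"]) simp

lemma poly_bounded_add: "poly_bounded f \<Longrightarrow> poly_bounded g \<Longrightarrow> poly_bounded (\<lambda>x. f x + g x)"
  unfolding poly_bounded_def by (metis add_mono poly_add)

lemma poly_bounded_mult: "poly_bounded f \<Longrightarrow> poly_bounded g \<Longrightarrow> poly_bounded (\<lambda>x. f x * g x)"
  unfolding poly_bounded_def by (metis mult_le_mono poly_mult)

lemmas poly_bounded_intros =
  poly_bounded_const poly_bounded_tsize poly_bounded_add poly_bounded_mult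

lemma poly_bounded_le: "poly_bounded g \<Longrightarrow> (\<And>x. f x \<le> g x) \<Longrightarrow> poly_bounded f"
  unfolding poly_bounded_def by (meson order_trans)

lemma poly_bounded_poly:
  assumes "poly_bounded f"
  shows "poly_bounded (\<lambda>x. poly p (f x))"
proof -
  obtain q where q: "\<And>x. f x \<le> poly q (tsize x)"
    using assms unfolding poly_bounded_def by blast
  have "poly p (f x) \<le> poly (pcompose p q) (tsize x)" for x
    using poly_mono_nat[OF q] by (simp add: poly_pcompose)
  then show ?thesis
    unfolding poly_bounded_def by blast
qed

lemma poly_bounded_comp:
  assumes "poly_bounded T" and "poly_bounded (\<lambda>x. tsize (f x))"
  shows "poly_bounded (\<lambda>x. T (f x))"
proof -
  obtain p where "\<And>x. T x \<le> poly p (tsize x)"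
    using assms(1) unfolding poly_bounded_def by blast
  then show ?thesis
    by (intro poly_bounded_le[OF poly_bounded_poly[OF assms(2), of p]])
qed

definition runs_within :: "prog \<Rightarrow> store \<Rightarrow> nat \<Rightarrow> store \<Rightarrow> bool" where
  "runs_within c s n s' \<longleftrightarrow> (\<exists>t\<le>n. exec c s t s')"

lemma runs_within_mono: "runs_within c s m s' \<Longrightarrow> m \<le> n \<Longrightarrow> runs_within c s n s'"
  unfolding runs_within_def by (meson order_trans)

lemma runs_within_Assign: "runs_within (Assign v e) s (eval_cost e s + 1) (s(v := eval e s))"
  unfolding runs_within_def using exec.Assign by blast

lemma runs_within_Seq:
  "runs_within c s n s' \<Longrightarrow> runs_within d s' n' s'' \<Longrightarrow> runs_within (Seq c d) s (n + n') s''"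
  unfolding runs_within_def by (metis add_mono exec.Seq)

lemma runs_within_If:
  "runs_within (if eval e s \<noteq> Leaf then c else d) s n s' \<Longrightarrow>
   runs_within (If e c d) s (eval_cost e s + 1 + n) s'"
  unfolding runs_within_def
  by (metis add_left_mono exec.IfFalse exec.IfTrue)

lemma runs_within_WhileFalse:
  "eval e s = Leaf \<Longrightarrow> runs_within (While e c) s (eval_cost e s + 1) s"
  unfolding runs_within_def using exec.WhileFalse by blast

lemma runs_within_WhileTrue:
  "eval e s \<noteq> Leaf \<Longrightarrow> runs_within c s n s' \<Longrightarrow> runs_within (While e c) s' n' s'' \<Longrightarrow>
   runs_within (While e c) s (eval_cost e s + 1 + n + n') s''"
  unfolding runs_within_def by (metis (no_types, lifting) add_le_mono add_left_mono exec.WhileTrue)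

lemma exec_tsize_le: "exec c s t s' \<Longrightarrow> tsize (s' v) \<le> tsize (s v) + t"
  by (induction rule: exec.induct) (use tsize_eval_le_cost in \<open>auto simp: trans_le_add2 le_SucI\<close>)

text \<open>The program has to work from every store, whatever its scratch variables below \<open>n\<close> contain,
  and must leave the variables from \<open>n\<close> on alone. This makes programs compose without renaming
  variables.\<close>

definition computes :: "prog \<Rightarrow> nat \<Rightarrow> (tree \<Rightarrow> nat) \<Rightarrow> (tree \<Rightarrow> tree) \<Rightarrow> bool" where
  "computes c n T f \<longleftrightarrow>
     (\<forall>s. \<exists>s'. runs_within c s (T (s 0)) s' \<and> s' 0 = f (s 0) \<and> (\<forall>m\<ge>n. s' m = s m))"

lemma computesE:
  assumes "computes c n T f"
  obtains s' where "runs_within c s (T (s 0)) s'" "s' 0 = f (s 0)" "\<forall>m\<ge>n. s' m = s m"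
  using assms unfolding computes_def by blast

definition poly_time :: "(tree \<Rightarrow> tree) \<Rightarrow> bool" where
  "poly_time f \<longleftrightarrow> (\<exists>c n T. n \<ge> 1 \<and> poly_bounded T \<and> computes c n T f)"

lemma poly_timeI: "computes c n T f \<Longrightarrow> 1 \<le> n \<Longrightarrow> poly_bounded T \<Longrightarrow> poly_time f"
  unfolding poly_time_def by blast

lemma poly_timeE:
  assumes "poly_time f"
  obtains c n T where "computes c n T f" "1 \<le> n" "poly_bounded T"
  using assms unfolding poly_time_def by blast

lemma poly_bounded_tsize_poly_time:
  assumes "poly_time f"
  shows "poly_bounded (\<lambda>x. tsize (f x))"
proof -
  obtain c n T where c: "computes c n T f" and T: "poly_bounded T"
    using assms by (rule poly_timeE)
  have "tsize (f x) \<le> tsize x + T x" for x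
  proof -
    obtain s' where "runs_within c (\<lambda>_. x) (T x) s'" "s' 0 = f x"
      using c by (rule computesE[where s = "\<lambda>_. x"])
    then show ?thesis
      unfolding runs_within_def using exec_tsize_le[of c "\<lambda>_. x" _ s' 0] by fastforce
  qed
  then show ?thesis
    by (intro poly_bounded_le[OF poly_bounded_add[OF poly_bounded_tsize T]])
qed

lemma poly_time_outputs_within:
  assumes "poly_time f"
  shows "\<exists>c p. \<forall>x. outputs_within c x (poly p (tsize x)) (f x)"
proof -
  obtain c n T where c: "computes c n T f" and T: "poly_bounded T"
    using assms by (rule poly_timeE)
  obtain p where p: "\<And>x. T x \<le> poly p (tsize x)"
    using T unfolding poly_bounded_def by blast
  have "outputs_within c x (poly p (tsize x)) (f x)" for x
  proof -
    have "init_store x 0 = x" by (simp add: init_store_def)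
    then obtain s' where "runs_within c (init_store x) (T x) s'" "s' 0 = f x"
      using computesE[OF c, of "init_store x"] by metis
    then show ?thesis
      unfolding outputs_within_def runs_within_def using p[of x] by (meson order_trans)
  qed
  then show ?thesis by blast
qed

lemma poly_time_expr:
  assumes "\<And>s. eval e s = f (s 0)" and "\<And>s. eval_cost e s \<le> n * tsize (s 0) + n"
  shows "poly_time f"
proof (rule poly_timeI)
  let ?T = "\<lambda>x. n * tsize x + n + 1"
  show "computes (Assign 0 e) 1 ?T f"
    unfolding computes_def
  proof
    fix s
    have "runs_within (Assign 0 e) s (?T (s 0)) (s(0 := f (s 0)))"
      using runs_within_mono[OF runs_within_Assign[of 0 e s]] assms by simp
    then show "\<exists>s'. runs_within (Assign 0 e) s (?T (s 0)) s' \<and> s' 0 = f (s 0) \<and> (\<forall>m\<ge>1. s' m = s m)"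
      by (intro exI[of _ "s(0 := f (s 0))"]) simp
  qed
  show "poly_bounded ?T"
    by (intro poly_bounded_intros)
qed simp

lemma poly_time_id: "poly_time (\<lambda>x. x)"
  by (rule poly_time_expr[of "Var 0" _ 1]) simp_all

lemma poly_time_const: "poly_time (\<lambda>x. t)"
proof -
  have "\<exists>e. \<forall>s. eval e s = t \<and> eval_cost e s = tsize t"
  proof (induction t)
    case Leaf
    show ?case by (rule exI[of _ LeafE]) simp
  next
    case (Node l r)
    then obtain a b where "\<forall>s. eval a s = l \<and> eval_cost a s = tsize l"
      "\<forall>s. eval b s = r \<and> eval_cost b s = tsize r" by blast
    then show ?case by (intro exI[of _ "NodeE a b"]) simp
  qed
  then obtain e where "\<forall>s. eval e s = t \<and> eval_cost e s = tsize t" by blast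
  then show ?thesis
    by (intro poly_time_expr[of e _ "tsize t"]) simp_all
qed

lemma poly_time_comp:
  assumes "poly_time g" and "poly_time f"
  shows "poly_time (\<lambda>x. g (f x))"
proof -
  obtain c n T where c: "computes c n T f" "1 \<le> n" and T: "poly_bounded T"
    using assms(2) by (rule poly_timeE)
  obtain d m U where d: "computes d m U g" and U: "poly_bounded U"
    using assms(1) by (rule poly_timeE)
  show ?thesis
  proof (rule poly_timeI)
    show "computes (Seq c d) (max n m) (\<lambda>x. T x + U (f x)) (\<lambda>x. g (f x))"
      unfolding computes_def
    proof
      fix s
      obtain s' where s': "runs_within c s (T (s 0)) s'" "s' 0 = f (s 0)" "\<forall>l\<ge>n. s' l = s l"
        using c(1) by (rule computesE[where s = s])
      obtain s'' where s'': "runs_within d s' (U (s' 0)) s''" "s'' 0 = g (s' 0)"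
          "\<forall>l\<ge>m. s'' l = s' l"
        using d by (rule computesE[where s = s'])
      show "\<exists>s'. runs_within (Seq c d) s (T (s 0) + U (f (s 0))) s' \<and> s' 0 = g (f (s 0)) \<and>
          (\<forall>l\<ge>max n m. s' l = s l)"
        using runs_within_Seq[OF s'(1) s''(1)] s'(2,3) s''(2,3) by auto
    qed
    show "poly_bounded (\<lambda>x. T x + U (f x))"
      by (intro poly_bounded_intros T poly_bounded_comp[OF U] poly_bounded_tsize_poly_time assms(2))
  qed (use c(2) in simp)
qed

lemma poly_time_left: "poly_time f \<Longrightarrow> poly_time (\<lambda>x. left (f x))"
  by (rule poly_time_comp[of left], rule poly_time_expr[of "LeftE (Var 0)" _ 1]) simp_all

lemma poly_time_right: "poly_time f \<Longrightarrow> poly_time (\<lambda>x. right (f x))"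
  by (rule poly_time_comp[of right], rule poly_time_expr[of "RightE (Var 0)" _ 1]) simp_all

lemma poly_time_keep_input:
  assumes "poly_time f"
  shows "poly_time (\<lambda>x. Node x (f x))"
proof -
  obtain c n T where c: "computes c n T f" "1 \<le> n" and T: "poly_bounded T"
    using assms by (rule poly_timeE)
  let ?save = "Assign n (Var 0)" and ?pair = "Assign 0 (NodeE (Var n) (Var 0))"
  let ?U = "\<lambda>x. (tsize x + 1) + (T x + (tsize x + tsize (f x) + 2))"
  show ?thesis
  proof (rule poly_timeI)
    show "computes (Seq ?save (Seq c ?pair)) (n + 1) ?U (\<lambda>x. Node x (f x))"
      unfolding computes_def
    proof
      fix s :: store
      let ?x = "s 0"
      have save: "runs_within ?save s (tsize ?x + 1) (s(n := ?x))"
        using runs_within_Assign[of n "Var 0" s] by simp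
      obtain s' where run: "runs_within c (s(n := ?x)) (T ?x) s'" and s': "s' 0 = f ?x"
          "\<forall>m\<ge>n. s' m = (s(n := ?x)) m"
        using computesE[OF c(1), of "s(n := ?x)"] c(2) by (metis fun_upd_other not_one_le_zero)
      have pair: "runs_within ?pair s' (tsize ?x + tsize (f ?x) + 2) (s'(0 := Node ?x (f ?x)))"
        using runs_within_Assign[of 0 "NodeE (Var n) (Var 0)" s'] s' by simp
      show "\<exists>s'. runs_within (Seq ?save (Seq c ?pair)) s (?U ?x) s' \<and> s' 0 = Node ?x (f ?x) \<and>
          (\<forall>m\<ge>n + 1. s' m = s m)"
        using runs_within_Seq[OF save runs_within_Seq[OF run pair]] s'(2)
        by (intro exI[of _ "s'(0 := Node ?x (f ?x))"]) simp
    qed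
    show "poly_bounded ?U"
      using T assms by (intro poly_bounded_intros poly_bounded_tsize_poly_time)
  qed simp
qed

lemma poly_time_Node:
  assumes "poly_time f" and "poly_time g"
  shows "poly_time (\<lambda>x. Node (f x) (g x))"
proof -
  have "poly_time (\<lambda>z. Node z (g (left z)))"
    by (intro poly_time_keep_input poly_time_comp[OF assms(2)] poly_time_left poly_time_id)
  from poly_time_comp[OF this poly_time_keep_input[OF assms(1)]]
  have "poly_time (\<lambda>x. Node (Node x (f x)) (g x))" by simp
  moreover have "poly_time (\<lambda>z. Node (right (left z)) (right z))"
    by (rule poly_time_expr[of "NodeE (RightE (LeftE (Var 0))) (RightE (Var 0))" _ 4]) simp_all
  ultimately show ?thesis
    using poly_time_comp[of "\<lambda>z. Node (right (left z)) (right z)" "\<lambda>x. Node (Node x (f x)) (g x)"]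
    by simp
qed

lemma poly_time_if_left:
  assumes "poly_time f" and "poly_time g"
  shows "poly_time (\<lambda>x. if left x \<noteq> Leaf then f x else g x)"
proof -
  obtain c n T where c: "computes c n T f" "1 \<le> n" and T: "poly_bounded T"
    using assms(1) by (rule poly_timeE)
  obtain d m U where d: "computes d m U g" and U: "poly_bounded U"
    using assms(2) by (rule poly_timeE)
  let ?W = "\<lambda>x. tsize x + 1 + 1 + (T x + U x)" and ?h = "\<lambda>x. if left x \<noteq> Leaf then f x else g x"
  show ?thesis
  proof (rule poly_timeI)
    show "computes (If (LeftE (Var 0)) c d) (max n m) ?W ?h"
      unfolding computes_def
    proof
      fix s :: store
      obtain s' where s': "runs_within c s (T (s 0)) s'" "s' 0 = f (s 0)" "\<forall>l\<ge>n. s' l = s l"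
        using c(1) by (rule computesE[where s = s])
      obtain s'' where s'': "runs_within d s (U (s 0)) s''" "s'' 0 = g (s 0)"
          "\<forall>l\<ge>m. s'' l = s l"
        using d by (rule computesE[where s = s])
      let ?s = "if left (s 0) \<noteq> Leaf then s' else s''"
      have "runs_within (if eval (LeftE (Var 0)) s \<noteq> Leaf then c else d) s (T (s 0) + U (s 0)) ?s"
        using runs_within_mono[OF s'(1)] runs_within_mono[OF s''(1)] by simp
      then have "runs_within (If (LeftE (Var 0)) c d) s (?W (s 0)) ?s"
        by (rule runs_within_mono[OF runs_within_If]) simp
      then show "\<exists>s'. runs_within (If (LeftE (Var 0)) c d) s (?W (s 0)) s' \<and> s' 0 = ?h (s 0) \<and>
          (\<forall>l\<ge>max n m. s' l = s l)"
        using s'(2,3) s''(2,3) by (intro exI[of _ ?s]) simp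
    qed
    show "poly_bounded ?W"
      using T U by (intro poly_bounded_intros)
  qed (use c(2) in simp)
qed

lemma runs_within_While_funpow:
  assumes c: "computes c n T f"
    and "\<And>j. j < N \<Longrightarrow> left ((f ^^ j) (s 0)) \<noteq> Leaf" and "left ((f ^^ N) (s 0)) = Leaf"
    and "\<And>j. j \<le> N \<Longrightarrow> tsize ((f ^^ j) (s 0)) + 2 + T ((f ^^ j) (s 0)) \<le> K"
  shows "\<exists>s'. runs_within (While (LeftE (Var 0)) c) s ((N + 1) * K) s' \<and>
    s' 0 = (f ^^ N) (s 0) \<and> (\<forall>m\<ge>n. s' m = s m)"
  using assms(2-)
proof (induction N arbitrary: s)
  case 0
  then have "runs_within (While (LeftE (Var 0)) c) s ((0 + 1) * K) s"
    by (intro runs_within_mono[OF runs_within_WhileFalse]) fastforce+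
  then show ?case by auto
next
  case (Suc N)
  obtain s' where s': "runs_within c s (T (s 0)) s'" "s' 0 = f (s 0)" "\<forall>m\<ge>n. s' m = s m"
    using c by (rule computesE[where s = s])
  have iterate: "(f ^^ j) (s' 0) = (f ^^ Suc j) (s 0)" for j
    by (simp add: s'(2) funpow_swap1)
  obtain s'' where s'': "runs_within (While (LeftE (Var 0)) c) s' ((N + 1) * K) s''"
    "s'' 0 = (f ^^ Suc N) (s 0)" "\<forall>m\<ge>n. s'' m = s' m"
    using Suc.IH[of s'] Suc.prems unfolding iterate by (metis Suc_le_mono Suc_mono)
  have "eval (LeftE (Var 0)) s \<noteq> Leaf"
    using Suc.prems(1)[of 0] by simp
  from runs_within_WhileTrue[OF this s'(1) s''(1)]
  have "runs_within (While (LeftE (Var 0)) c) s ((Suc N + 1) * K) s''"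
    by (rule runs_within_mono) (use Suc.prems(3)[of 0] in simp)
  then show ?case
    using s'(3) s''(2,3) by auto
qed

lemma computes_While:
  assumes f: "computes c n T f" and i: "computes d m U i"
    and continue: "\<And>x j. j < N x \<Longrightarrow> left ((f ^^ j) (i x)) \<noteq> Leaf"
    and stop: "\<And>x. left ((f ^^ N x) (i x)) = Leaf"
    and cost: "\<And>x j. j \<le> N x \<Longrightarrow> tsize ((f ^^ j) (i x)) + 2 + T ((f ^^ j) (i x)) \<le> K x"
  shows "computes (Seq d (While (LeftE (Var 0)) c)) (max n m) (\<lambda>x. U x + (N x + 1) * K x)
    (\<lambda>x. (f ^^ N x) (i x))"
  unfolding computes_def
proof
  fix s :: store
  let ?x = "s 0" and ?loop = "While (LeftE (Var 0)) c"
  obtain s' where s': "runs_within d s (U ?x) s'" "s' 0 = i ?x" "\<forall>l\<ge>m. s' l = s l"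
    using i by (rule computesE[where s = s])
  obtain s'' where s'': "runs_within ?loop s' ((N ?x + 1) * K ?x) s''"
    "s'' 0 = (f ^^ N ?x) (s' 0)" "\<forall>l\<ge>n. s'' l = s' l"
    using runs_within_While_funpow[OF f, of "N ?x" s' "K ?x"] continue stop cost
    unfolding s'(2) by blast
  show "\<exists>s'. runs_within (Seq d ?loop) s (U ?x + (N ?x + 1) * K ?x) s' \<and>
      s' 0 = (f ^^ N ?x) (i ?x) \<and> (\<forall>l\<ge>max n m. s' l = s l)"
    using runs_within_Seq[OF s'(1) s''(1)] s'(2,3) s''(2,3) by auto
qed

lemma poly_time_while:
  assumes f: "poly_time f" and i: "poly_time i" and Q: "poly_bounded Q"
    and N: "\<And>x. N x \<le> Q x"
    and size: "\<And>x j. j \<le> N x \<Longrightarrow> tsize ((f ^^ j) (i x)) \<le> Q x"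
    and continue: "\<And>x j. j < N x \<Longrightarrow> left ((f ^^ j) (i x)) \<noteq> Leaf"
    and stop: "\<And>x. left ((f ^^ N x) (i x)) = Leaf"
  shows "poly_time (\<lambda>x. (f ^^ N x) (i x))"
proof -
  obtain c n T where c: "computes c n T f" "1 \<le> n" and T: "poly_bounded T"
    using f by (rule poly_timeE)
  obtain d m U where d: "computes d m U i" and U: "poly_bounded U"
    using i by (rule poly_timeE)
  obtain p where p: "\<And>x. T x \<le> poly p (tsize x)"
    using T unfolding poly_bounded_def by blast
  let ?K = "\<lambda>x. Q x + 2 + poly p (Q x)"
  have cost: "tsize ((f ^^ j) (i x)) + 2 + T ((f ^^ j) (i x)) \<le> ?K x" if "j \<le> N x" for x j
    using size[OF that] p[of "(f ^^ j) (i x)"] poly_mono_nat[OF size[OF that], of p] by linarith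
  show ?thesis
  proof (rule poly_timeI)
    show "computes (Seq d (While (LeftE (Var 0)) c)) (max n m) (\<lambda>x. U x + (N x + 1) * ?K x)
        (\<lambda>x. (f ^^ N x) (i x))"
      by (rule computes_While[OF c(1) d continue stop cost])
    have "poly_bounded (\<lambda>x. U x + (Q x + 1) * ?K x)"
      using U Q by (intro poly_bounded_intros poly_bounded_poly)
    then show "poly_bounded (\<lambda>x. U x + (N x + 1) * ?K x)"
      by (rule poly_bounded_le) (simp add: N add_mono mult_le_mono1)
  qed (use c(2) in simp)
qed

lemma poly_time_ternary:
  assumes "poly_time (\<lambda>z. f (left (left z)) (right (left z)) (right z))"
    and "poly_time a" and "poly_time b" and "poly_time c"
  shows "poly_time (\<lambda>x. f (a x) (b x) (c x))"
  using poly_time_comp[OF assms(1) poly_time_Node[OF poly_time_Node[OF assms(2,3)] assms(4)]]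
  by simp

section \<open>Polynomial-time predicates and lists\<close>

primrec list_of_tree :: "tree \<Rightarrow> tree list" where
  "list_of_tree Leaf = []"
| "list_of_tree (Node l r) = l # list_of_tree r"

primrec tree_of_list :: "tree list \<Rightarrow> tree" where
  "tree_of_list [] = Leaf"
| "tree_of_list (x # xs) = Node x (tree_of_list xs)"

lemma list_of_tree_of_list [simp]: "list_of_tree (tree_of_list xs) = xs"
  by (induction xs) auto

lemma tree_of_list_eq_iff [simp]: "tree_of_list xs = tree_of_list ys \<longleftrightarrow> xs = ys"
  by (metis list_of_tree_of_list)

lemma tree_of_list_of_tree [simp]: "tree_of_list (list_of_tree t) = t"
  by (induction t) auto

lemma tsize_tree_of_list: "tsize (tree_of_list xs) = 1 + (\<Sum>x\<leftarrow>xs. tsize x + 1)"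
  by (induction xs) auto

lemma length_le_tsize: "length xs \<le> tsize (tree_of_list xs)"
  by (induction xs) auto

lemma tsize_le_tree_of_list: "x \<in> set xs \<Longrightarrow> tsize x \<le> tsize (tree_of_list xs)"
  by (induction xs) auto

lemma tsize_tree_of_list_le:
  assumes "\<And>x. x \<in> set xs \<Longrightarrow> tsize x \<le> m" and "length xs \<le> n"
  shows "tsize (tree_of_list xs) \<le> 1 + n * (m + 1)"
proof -
  have "(\<Sum>x\<leftarrow>xs. tsize x + 1) \<le> (\<Sum>x\<leftarrow>xs. m + 1)"
    using assms(1) by (intro sum_list_mono) simp
  also have "\<dots> \<le> n * (m + 1)"
    using assms(2) by (simp only: sum_list_triv of_nat_id mult_le_mono1)
  finally show ?thesis by (simp only: tsize_tree_of_list add_le_cancel_left)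
qed

lemma tsize_drop_le: "tsize (tree_of_list (drop n xs)) \<le> tsize (tree_of_list xs)"
  by (subst (2) append_take_drop_id[of n xs, symmetric])
    (simp only: tsize_tree_of_list map_append sum_list_append)

definition poly_time_pred :: "(tree \<Rightarrow> bool) \<Rightarrow> bool" where
  "poly_time_pred P \<longleftrightarrow> poly_time (\<lambda>x. enc_bool (P x))"

definition poly_time_list :: "(tree \<Rightarrow> tree list) \<Rightarrow> bool" where
  "poly_time_list L \<longleftrightarrow> poly_time (\<lambda>x. tree_of_list (L x))"

lemma poly_time_tree_of_list: "poly_time_list L \<Longrightarrow> poly_time (\<lambda>x. tree_of_list (L x))"
  by (simp add: poly_time_list_def)

lemma poly_time_list_of_tree: "poly_time f \<Longrightarrow> poly_time_list (\<lambda>x. list_of_tree (f x))"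
  by (simp add: poly_time_list_def)

lemma poly_time_list_comp: "poly_time_list L \<Longrightarrow> poly_time f \<Longrightarrow> poly_time_list (\<lambda>x. L (f x))"
  unfolding poly_time_list_def by (rule poly_time_comp)

lemma poly_time_list_binary:
  assumes "poly_time_list (\<lambda>z. f (left z) (right z))" and "poly_time a" and "poly_time b"
  shows "poly_time_list (\<lambda>x. f (a x) (b x))"
  using poly_time_list_comp[OF assms(1) poly_time_Node[OF assms(2,3)]] by simp

lemma poly_time_pred_ternary:
  assumes "poly_time_pred (\<lambda>z. P (left (left z)) (right (left z)) (right z))"
    and "poly_time a" and "poly_time b" and "poly_time c"
  shows "poly_time_pred (\<lambda>x. P (a x) (b x) (c x))"
  using assms(2-4) unfolding poly_time_pred_def
  by (rule poly_time_ternary[OF assms(1)[unfolded poly_time_pred_def]])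

lemma enc_bool_eq_Leaf_iff [simp]: "enc_bool b = Leaf \<longleftrightarrow> \<not> b"
  by (cases b) auto

lemma poly_time_if:
  assumes "poly_time_pred P" and "poly_time f" and "poly_time g"
  shows "poly_time (\<lambda>x. if P x then f x else g x)"
proof -
  have "poly_time (\<lambda>z. if left z \<noteq> Leaf then f (right z) else g (right z))"
    by (intro poly_time_if_left poly_time_comp[OF assms(2)] poly_time_comp[OF assms(3)]
        poly_time_right poly_time_id)
  from poly_time_comp[OF this poly_time_Node[OF assms(1)[unfolded poly_time_pred_def] poly_time_id]]
  show ?thesis by (simp cong: if_cong)
qed

lemma poly_time_list_if:
  "poly_time_pred P \<Longrightarrow> poly_time_list K \<Longrightarrow> poly_time_list L \<Longrightarrow>
   poly_time_list (\<lambda>x. if P x then K x else L x)"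
  using poly_time_if[of P "\<lambda>x. tree_of_list (K x)" "\<lambda>x. tree_of_list (L x)"]
  by (simp add: poly_time_list_def if_distrib[of tree_of_list])

lemma poly_time_pred_if:
  "poly_time_pred P \<Longrightarrow> poly_time_pred Q \<Longrightarrow> poly_time_pred R \<Longrightarrow>
   poly_time_pred (\<lambda>x. if P x then Q x else R x)"
  using poly_time_if[of P "\<lambda>x. enc_bool (Q x)" "\<lambda>x. enc_bool (R x)"]
  by (simp add: poly_time_pred_def if_distrib[of enc_bool])

lemma poly_time_pred_const: "poly_time_pred (\<lambda>x. b)"
  by (simp add: poly_time_pred_def poly_time_const)

lemma poly_time_pred_not: "poly_time_pred P \<Longrightarrow> poly_time_pred (\<lambda>x. \<not> P x)"
  using poly_time_pred_if[of P "\<lambda>x. False" "\<lambda>x. True"] poly_time_pred_const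
  by (simp add: if_bool_eq_conj)

lemma poly_time_pred_conj:
  "poly_time_pred P \<Longrightarrow> poly_time_pred Q \<Longrightarrow> poly_time_pred (\<lambda>x. P x \<and> Q x)"
  using poly_time_pred_if[of P Q "\<lambda>x. False"] poly_time_pred_const
  by (simp add: if_bool_eq_disj)

lemma poly_time_pred_disj:
  "poly_time_pred P \<Longrightarrow> poly_time_pred Q \<Longrightarrow> poly_time_pred (\<lambda>x. P x \<or> Q x)"
  using poly_time_pred_not[OF poly_time_pred_conj, of "\<lambda>x. \<not> P x" "\<lambda>x. \<not> Q x"]
    poly_time_pred_not by simp

lemma poly_time_pred_imp:
  "poly_time_pred P \<Longrightarrow> poly_time_pred Q \<Longrightarrow> poly_time_pred (\<lambda>x. P x \<longrightarrow> Q x)"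
  unfolding imp_conv_disj by (intro poly_time_pred_disj poly_time_pred_not)

lemma poly_time_pred_eq:
  assumes "poly_time f" and "poly_time g"
  shows "poly_time_pred (\<lambda>x. f x = g x)"
proof -
  have "poly_time (\<lambda>z. enc_bool (left z = right z))"
    by (rule poly_time_expr[of "EqE (LeftE (Var 0)) (RightE (Var 0))" _ 3]) simp_all
  from poly_time_comp[OF this poly_time_Node[OF assms]] show ?thesis
    by (simp add: poly_time_pred_def)
qed

lemma poly_bounded_length:
  assumes "poly_time_list L"
  shows "poly_bounded (\<lambda>x. length (L x))"
  using poly_bounded_tsize_poly_time[OF poly_time_tree_of_list[OF assms]] length_le_tsize
  by (rule poly_bounded_le)

lemma poly_bounded_on_list:
  assumes "poly_time_list L" and "poly_time (\<lambda>z. f (left z) (right z))"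
  obtains Q where "poly_bounded Q" "\<forall>x. \<forall>e\<in>set (L x). tsize (f x e) \<le> Q x"
proof -
  obtain p where p: "\<And>z. tsize (f (left z) (right z)) \<le> poly p (tsize z)"
    using poly_bounded_tsize_poly_time[OF assms(2)] unfolding poly_bounded_def by blast
  let ?Q = "\<lambda>x. poly p (tsize x + tsize (tree_of_list (L x)) + 1)"
  show thesis
  proof (rule that)
    show "poly_bounded ?Q"
      using assms(1) by (intro poly_bounded_poly poly_bounded_intros poly_bounded_tsize_poly_time
          poly_time_tree_of_list)
    show "\<forall>x. \<forall>e\<in>set (L x). tsize (f x e) \<le> ?Q x"
    proof (intro allI ballI)
      fix x e assume "e \<in> set (L x)"
      then have "tsize (Node x e) \<le> tsize x + tsize (tree_of_list (L x)) + 1"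
        using tsize_le_tree_of_list by simp
      then show "tsize (f x e) \<le> ?Q x"
        using p[of "Node x e"] poly_mono_nat[of "tsize (Node x e)" _ p] by fastforce
    qed
  qed
qed

lemma poly_time_foldl:
  assumes L: "poly_time_list L" and i: "poly_time i"
    and g: "poly_time (\<lambda>z. g (left (left z)) (right (left z)) (right z))"
    and Q: "poly_bounded Q"
    and size: "\<And>x n. n \<le> length (L x) \<Longrightarrow> tsize (foldl (g x) (i x) (take n (L x))) \<le> Q x"
  shows "poly_time (\<lambda>x. foldl (g x) (i x) (L x))"
proof -
  let ?init = "\<lambda>x. Node (tree_of_list (L x)) (Node x (i x))"
  let ?step = "\<lambda>z. Node (right (left z)) (Node (left (right z))
    (g (left (right z)) (right (right z)) (left (left z))))"
  have step: "poly_time ?step"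
    by (intro poly_time_Node poly_time_ternary[OF g] poly_time_left poly_time_right poly_time_id)
  have iterate: "(?step ^^ n) (?init x) =
      Node (tree_of_list (drop n (L x))) (Node x (foldl (g x) (i x) (take n (L x))))"
    if "n \<le> length (L x)" for n x
    using that
  proof (induction n)
    case (Suc n)
    then have "n < length (L x)" by simp
    then show ?case
      using Suc.IH by (simp add: take_Suc_conv_app_nth Cons_nth_drop_Suc[symmetric])
  qed simp
  let ?R = "\<lambda>x. tsize (tree_of_list (L x)) + (tsize x + Q x + 1) + 1"
  have "poly_time (\<lambda>x. (?step ^^ length (L x)) (?init x))"
  proof (rule poly_time_while[where Q = ?R])
    show "poly_time ?init"
      using L i by (intro poly_time_Node poly_time_id poly_time_tree_of_list)
    show "poly_bounded ?R"
      using L Q by (intro poly_bounded_intros poly_bounded_tsize_poly_time poly_time_tree_of_list)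
    show "length (L x) \<le> ?R x" for x
      using length_le_tsize[of "L x"] by simp
    show "tsize ((?step ^^ n) (?init x)) \<le> ?R x" if "n \<le> length (L x)" for x n
      using iterate[OF that] size[OF that] tsize_drop_le[of n "L x"] by simp
    show "left ((?step ^^ n) (?init x)) \<noteq> Leaf" if "n < length (L x)" for x n
      using iterate[of n x] that by (simp add: Cons_nth_drop_Suc[symmetric])
    show "left ((?step ^^ length (L x)) (?init x)) = Leaf" for x
      using iterate[of "length (L x)" x] by simp
  qed (rule step)
  then have "poly_time (\<lambda>x. right (right ((?step ^^ length (L x)) (?init x))))"
    by (intro poly_time_right)
  then show ?thesis using iterate[OF order_refl] by simp
qed

lemma poly_time_foldl_additive:
  assumes L: "poly_time_list L" and i: "poly_time i"
    and g: "poly_time (\<lambda>z. g (left (left z)) (right (left z)) (right z))"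
    and Q: "poly_bounded Q"
    and size: "\<And>x a e. e \<in> set (L x) \<Longrightarrow> tsize (g x a e) \<le> tsize a + Q x"
  shows "poly_time (\<lambda>x. foldl (g x) (i x) (L x))"
proof (rule poly_time_foldl[OF L i g])
  let ?Q = "\<lambda>x. tsize (i x) + length (L x) * Q x"
  show "poly_bounded ?Q"
    using i Q L by (intro poly_bounded_intros poly_bounded_tsize_poly_time poly_bounded_length)
  show "tsize (foldl (g x) (i x) (take n (L x))) \<le> ?Q x" if "n \<le> length (L x)" for x n
  proof -
    have "tsize (foldl (g x) a es) \<le> tsize a + length es * Q x" if "set es \<subseteq> set (L x)" for a es
      using that
    proof (induction es arbitrary: a)
      case (Cons e es)
      have "tsize (foldl (g x) (g x a e) es) \<le> tsize (g x a e) + length es * Q x"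
        using Cons by simp
      then show ?case using size[of e x a] Cons.prems by simp
    qed simp
    from this[OF set_take_subset]
    have "tsize (foldl (g x) (i x) (take n (L x))) \<le> tsize (i x) + n * Q x"
      using that by (metis length_take min_absorb2)
    also have "\<dots> \<le> ?Q x" using that by simp
    finally show ?thesis .
  qed
qed

lemma poly_time_list_rev:
  assumes "poly_time_list L"
  shows "poly_time_list (\<lambda>x. rev (L x))"
proof -
  have "poly_time (\<lambda>x. foldl (\<lambda>a e. Node e a) Leaf (L x))"
  proof (rule poly_time_foldl_additive[where Q = "\<lambda>x. tsize (tree_of_list (L x)) + 1"])
    show "tsize (Node e a) \<le> tsize a + (tsize (tree_of_list (L x)) + 1)"
      if "e \<in> set (L x)" for x a e
      using tsize_le_tree_of_list[OF that] by simp
  qed (intro assms poly_time_const poly_time_Node poly_time_left poly_time_right poly_time_id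
      poly_bounded_intros poly_bounded_tsize_poly_time poly_time_tree_of_list)+
  moreover have "foldl (\<lambda>a e. Node e a) (tree_of_list ys) xs = tree_of_list (rev xs @ ys)" for xs ys
    by (induction xs arbitrary: ys) (simp_all flip: tree_of_list.simps(2))
  from this[of "[]"] have "foldl (\<lambda>a e. Node e a) Leaf xs = tree_of_list (rev xs)" for xs
    by simp
  ultimately show ?thesis by (simp add: poly_time_list_def)
qed

lemma poly_time_foldr:
  assumes L: "poly_time_list L" and i: "poly_time i"
    and g: "poly_time (\<lambda>z. g (left (left z)) (right z) (right (left z)))"
    and Q: "poly_bounded Q"
    and size: "\<And>x a e. e \<in> set (L x) \<Longrightarrow> tsize (g x e a) \<le> tsize a + Q x"
  shows "poly_time (\<lambda>x. foldr (g x) (L x) (i x))"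
  unfolding foldr_conv_foldl
  by (rule poly_time_foldl_additive[OF poly_time_list_rev[OF L] i g Q]) (simp add: size)

lemma poly_time_list_Nil: "poly_time_list (\<lambda>x. [])"
  by (simp add: poly_time_list_def poly_time_const)

lemma poly_time_list_Cons:
  "poly_time f \<Longrightarrow> poly_time_list L \<Longrightarrow> poly_time_list (\<lambda>x. f x # L x)"
  by (simp add: poly_time_list_def poly_time_Node)

lemma poly_time_list_append:
  assumes "poly_time_list K" and "poly_time_list L"
  shows "poly_time_list (\<lambda>x. K x @ L x)"
proof -
  have "poly_time (\<lambda>x. foldr Node (K x) (tree_of_list (L x)))"
  proof (rule poly_time_foldr[where Q = "\<lambda>x. tsize (tree_of_list (K x)) + 1"])
    show "tsize (Node e a) \<le> tsize a + (tsize (tree_of_list (K x)) + 1)"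
      if "e \<in> set (K x)" for x a e
      using tsize_le_tree_of_list[OF that] by simp
  qed (intro assms poly_time_Node poly_time_left poly_time_right poly_time_id
      poly_bounded_intros poly_bounded_tsize_poly_time poly_time_tree_of_list)+
  moreover have "foldr Node xs (tree_of_list ys) = tree_of_list (xs @ ys)" for xs ys
    by (induction xs) simp_all
  ultimately show ?thesis by (simp add: poly_time_list_def)
qed

lemma poly_time_list_concat_map:
  assumes L: "poly_time_list L" and f: "poly_time_list (\<lambda>z. f (left z) (right z))"
  shows "poly_time_list (\<lambda>x. concat (map (\<lambda>e. f x e) (L x)))"
proof -
  obtain Q where Q: "poly_bounded Q"
    and size: "\<forall>x. \<forall>e\<in>set (L x). tsize (tree_of_list (f x e)) \<le> Q x"
    using poly_bounded_on_list[OF L poly_time_tree_of_list[OF f]] .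
  have "poly_time (\<lambda>z. tree_of_list (f (left (left z)) (right z) @ list_of_tree (right (left z))))"
    by (intro poly_time_tree_of_list poly_time_list_append poly_time_list_of_tree
        poly_time_list_binary[OF f] poly_time_left poly_time_right poly_time_id)
  then have "poly_time (\<lambda>x. foldr (\<lambda>e a. tree_of_list (f x e @ list_of_tree a)) (L x) Leaf)"
  proof (rule poly_time_foldr[OF L poly_time_const _ Q])
    show "tsize (tree_of_list (f x e @ list_of_tree a)) \<le> tsize a + Q x"
      if "e \<in> set (L x)" for x a e
    proof -
      have "tsize (tree_of_list (f x e)) \<le> Q x" using size that by blast
      then show ?thesis
        using tsize_tree_of_list[of "list_of_tree a"] by (simp add: tsize_tree_of_list)
    qed
  qed
  moreover have "foldr (\<lambda>e a. tree_of_list (h e @ list_of_tree a)) xs Leaf =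
      tree_of_list (concat (map h xs))" for h and xs :: "tree list"
    by (induction xs) simp_all
  ultimately show ?thesis by (simp add: poly_time_list_def)
qed

lemma poly_time_list_map:
  assumes "poly_time_list L" and "poly_time (\<lambda>z. f (left z) (right z))"
  shows "poly_time_list (\<lambda>x. map (\<lambda>e. f x e) (L x))"
  using poly_time_list_concat_map[OF assms(1) poly_time_list_Cons[OF assms(2) poly_time_list_Nil]]
  by simp

lemma poly_time_list_filter:
  assumes "poly_time_list L" and "poly_time_pred (\<lambda>z. P (left z) (right z))"
  shows "poly_time_list (\<lambda>x. filter (\<lambda>e. P x e) (L x))"
proof -
  have "poly_time_list (\<lambda>x. concat (map (\<lambda>e. if P x e then [e] else []) (L x)))"
    by (intro poly_time_list_concat_map poly_time_list_if poly_time_list_Cons poly_time_list_Nil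
        poly_time_right poly_time_id assms)
  moreover have "concat (map (\<lambda>e. if Q e then [e] else []) xs) = filter Q xs"
    for Q and xs :: "tree list"
    by (induction xs) auto
  ultimately show ?thesis by simp
qed

lemma poly_time_pred_bex:
  assumes "poly_time_list L" and "poly_time_pred (\<lambda>z. P (left z) (right z))"
  shows "poly_time_pred (\<lambda>x. \<exists>e\<in>set (L x). P x e)"
proof -
  have "poly_time_pred (\<lambda>x. tree_of_list (filter (\<lambda>e. P x e) (L x)) \<noteq> tree_of_list [])"
    by (intro poly_time_pred_not poly_time_pred_eq poly_time_tree_of_list poly_time_list_filter
        poly_time_list_Nil assms)
  then show ?thesis by (simp only: tree_of_list_eq_iff filter_empty_conv) simp
qed

lemma poly_time_pred_ball:
  assumes "poly_time_list L" and "poly_time_pred (\<lambda>z. P (left z) (right z))"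
  shows "poly_time_pred (\<lambda>x. \<forall>e\<in>set (L x). P x e)"
  using poly_time_pred_not[OF poly_time_pred_bex[OF assms(1) poly_time_pred_not[OF assms(2)]]]
  by simp

lemma poly_time_pred_mem:
  assumes "poly_time f" and "poly_time_list L"
  shows "poly_time_pred (\<lambda>x. f x \<in> set (L x))"
proof -
  have "poly_time_pred (\<lambda>x. \<exists>e\<in>set (L x). e = f x)"
    by (intro poly_time_pred_bex poly_time_pred_eq poly_time_comp[OF assms(1)] poly_time_left
        poly_time_right poly_time_id assms(2))
  then show ?thesis by simp
qed

lemma poly_time_pred_subset:
  assumes "poly_time_list K" and "poly_time_list L"
  shows "poly_time_pred (\<lambda>x. set (K x) \<subseteq> set (L x))"
  unfolding subset_eq
  by (intro poly_time_pred_ball poly_time_pred_mem poly_time_list_comp[OF assms(2)] assms(1)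
      poly_time_left poly_time_right poly_time_id)

lemma poly_time_pred_set_eq:
  "poly_time_list K \<Longrightarrow> poly_time_list L \<Longrightarrow> poly_time_pred (\<lambda>x. set (K x) = set (L x))"
  unfolding set_eq_subset by (intro poly_time_pred_conj poly_time_pred_subset)

lemmas poly_time_intros = poly_time_id poly_time_const poly_time_left poly_time_right
  poly_time_Node poly_time_if poly_time_tree_of_list
  poly_time_list_of_tree poly_time_list_if poly_time_list_append poly_time_list_Nil
  poly_time_list_Cons poly_time_list_map poly_time_list_filter poly_time_list_concat_map
  poly_time_pred_const poly_time_pred_not poly_time_pred_conj poly_time_pred_disj
  poly_time_pred_imp poly_time_pred_eq poly_time_pred_bex poly_time_pred_ball
  poly_time_pred_mem poly_time_pred_set_eq

section \<open>Saturation of a finite list\<close>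

definition saturation :: "'a list \<Rightarrow> ('a list \<Rightarrow> 'a \<Rightarrow> bool) \<Rightarrow> 'a list" where
  "saturation U R = ((\<lambda>S. filter (\<lambda>u. u \<in> set S \<or> R S u) U) ^^ length U) []"

lemma saturation_sound:
  assumes "\<And>S u. set S \<subseteq> T \<Longrightarrow> u \<in> set U \<Longrightarrow> R S u \<Longrightarrow> u \<in> T"
  shows "set (saturation U R) \<subseteq> T"
proof -
  have "set (((\<lambda>S. filter (\<lambda>u. u \<in> set S \<or> R S u) U) ^^ n) []) \<subseteq> T" for n
    by (induction n) (use assms in auto)
  then show ?thesis by (simp add: saturation_def)
qed

lemma saturation_closed:
  assumes "u \<in> set U" and "R (saturation U R) u"
  shows "u \<in> set (saturation U R)"
proof -
  define S where "S n = ((\<lambda>S. filter (\<lambda>u. u \<in> set S \<or> R S u) U) ^^ n) []" for n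
  have S_Suc: "S (Suc n) = filter (\<lambda>u. u \<in> set (S n) \<or> R (S n) u) U" for n
    by (simp add: S_def)
  have S_filter: "S n = filter (\<lambda>u. u \<in> set (S n)) U" for n
    by (cases n) (simp_all add: S_Suc cong: filter_cong, simp add: S_def)
  have stable: "S (Suc n) = S (Suc (Suc n))" if "set (S n) = set (S (Suc n))" for n
    using that S_filter S_Suc by metis
  have bounded: "set (S n) \<subseteq> set U" for n
    by (subst S_filter) auto
  then have mono: "mono (\<lambda>n. set (S n))"
    unfolding mono_iff_le_Suc by (auto simp: S_Suc)
  have "finite (range (\<lambda>n. set (S n)))"
    by (meson PowI bounded finite_Pow_iff finite_set finite_subset image_subsetI)
  then have "(\<Union>n. set (S n)) = set (S (card (set U)))"
    using mono stable
    by (intro finite_mono_strict_prefix_implies_finite_fixpoint[symmetric]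
        finite_mono_remains_stable_implies_strict_prefix bounded) auto
  also have "\<dots> \<subseteq> set (S (length U))"
    using mono card_length by (rule monoD)
  finally have "set (S (Suc (length U))) \<subseteq> set (S (length U))"
    by blast
  moreover have "u \<in> set (S (Suc (length U)))"
    using assms by (simp add: S_Suc saturation_def flip: S_def)
  ultimately show ?thesis
    by (auto simp: saturation_def simp flip: S_def)
qed

lemma poly_time_list_saturation:
  assumes U: "poly_time_list U"
    and R: "poly_time_pred (\<lambda>z. R (left (left z)) (list_of_tree (right (left z))) (right z))"
  shows "poly_time_list (\<lambda>x. saturation (U x) (R x))"
proof -
  let ?step = "\<lambda>x S. filter (\<lambda>u. u \<in> set S \<or> R x S u) (U x)"
  let ?g = "\<lambda>x t e. tree_of_list (?step x (list_of_tree t))"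
  have "poly_time (\<lambda>x. foldl (?g x) Leaf (U x))"
  proof (rule poly_time_foldl_additive[OF U poly_time_const])
    show "poly_time (\<lambda>z. ?g (left (left z)) (right (left z)) (right z))"
      by (intro poly_time_intros poly_time_list_comp[OF U]
          poly_time_pred_ternary[where P = "\<lambda>x t. R x (list_of_tree t)", OF R])
    show "poly_bounded (\<lambda>x. tsize (tree_of_list (U x)))"
      by (intro poly_bounded_tsize_poly_time poly_time_tree_of_list U)
    show "tsize (?g x a e) \<le> tsize a + tsize (tree_of_list (U x))" for x a e
      by (simp add: tsize_tree_of_list sum_list_filter_le_nat trans_le_add2)
  qed
  moreover have "foldl (?g x) (tree_of_list S) es = tree_of_list ((?step x ^^ length es) S)"
    for x S and es :: "tree list"
    by (induction es arbitrary: S) (simp_all add: funpow_Suc_right del: funpow.simps(2))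
  from this[of _ "[]"] have "foldl (?g x) Leaf (U x) = tree_of_list (saturation (U x) (R x))" for x
    by (simp add: saturation_def)
  ultimately show ?thesis by (simp add: poly_time_list_def)
qed

section \<open>Subformula occurrences\<close>

lemma subformula_snoc:
  "subformula \<phi> (i @ [n]) = (case subformula \<phi> i of None \<Rightarrow> None
     | Some \<psi> \<Rightarrow> if n < length (children \<psi>) then Some (children \<psi> ! n) else None)"
  by (induction \<phi> i rule: subformula.induct) auto

lemma snoc_in_indices_iff:
  "i @ [n] \<in> indices \<phi> \<longleftrightarrow> i \<in> indices \<phi> \<and> n < length (children (subf \<phi> i))"
  unfolding indices_def subf_def by (auto simp: subformula_snoc split: option.splits if_splits)

lemma subf_snoc: "i @ [n] \<in> indices \<phi> \<Longrightarrow> subf \<phi> (i @ [n]) = children (subf \<phi> i) ! n"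
  unfolding indices_def subf_def by (auto simp: subformula_snoc split: option.splits if_splits)

lemma Nil_in_indices [simp]: "[] \<in> indices \<phi>"
  by (simp add: indices_def)

lemma subf_Nil [simp]: "subf \<phi> [] = \<phi>"
  by (simp add: subf_def)

lemma parent_iff_snoc: "parent \<phi> i j \<longleftrightarrow> j \<in> indices \<phi> \<and> (\<exists>n. j = i @ [n])"
  unfolding parent_def using snoc_in_indices_iff by blast

lemma parent_in_indices:
  assumes "parent \<phi> i j"
  shows "i \<in> indices \<phi>" and "j \<in> indices \<phi>"
  using assms by (simp_all add: parent_def)

lemma set_children_subf:
  assumes "i \<in> indices \<phi>"
  shows "set (children (subf \<phi> i)) = subf \<phi> ` {j. parent \<phi> i j}"
proof -
  have "{j. parent \<phi> i j} = (\<lambda>n. i @ [n]) ` {..<length (children (subf \<phi> i))}"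
    using assms by (auto simp: parent_iff_snoc snoc_in_indices_iff)
  moreover have "subf \<phi> (i @ [n]) = children (subf \<phi> i) ! n"
    if "n < length (children (subf \<phi> i))" for n
    using assms that by (simp add: subf_snoc snoc_in_indices_iff)
  ultimately show ?thesis
    by (force simp: set_conv_nth image_image)
qed

lemma size_children: "\<chi> \<in> set (children \<psi>) \<Longrightarrow> size \<chi> < size \<psi>"
  by (cases \<psi>) (auto simp: less_Suc_eq_le intro: size_list_estimation')

lemma well_sorted_subf: "well_sorted \<Sigma> \<phi> \<Longrightarrow> i \<in> indices \<phi> \<Longrightarrow> well_sorted \<Sigma> (subf \<phi> i)"
proof (induction i rule: rev_induct)
  case (snoc n i)
  then have "subf \<phi> (i @ [n]) \<in> set (children (subf \<phi> i))" "well_sorted \<Sigma> (subf \<phi> i)"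
    by (simp_all add: snoc_in_indices_iff subf_snoc)
  then show ?case by (cases "subf \<phi> i") (auto simp: list_all_iff)
qed simp

primrec bound_vars :: "('v, 's, 'r) qc \<Rightarrow> ('v, 's) var set" where
  "bound_vars (Atom R vs) = {}"
| "bound_vars (Conj \<psi>s) = {}"
| "bound_vars (Forall y \<psi>) = {y}"
| "bound_vars (Exists y \<psi>) = {y}"

lemma free_iff:
  "v \<in> free \<psi> \<longleftrightarrow> (\<exists>R vs. \<psi> = Atom R vs \<and> v \<in> set vs) \<or>
    v \<notin> bound_vars \<psi> \<and> (\<exists>\<chi>\<in>set (children \<psi>). v \<in> free \<chi>)"
  by (cases \<psi>) auto

lemma finite_free: "finite (free \<psi>)"
  by (induction \<psi>) auto

inductive free_at :: "('v, 's, 'r) qc \<Rightarrow> index \<Rightarrow> ('v, 's) var \<Rightarrow> bool"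
  for \<phi> :: "('v, 's, 'r) qc" where
  free_at_atom: "\<lbrakk>i \<in> indices \<phi>; subf \<phi> i = Atom R vs; v \<in> set vs\<rbrakk> \<Longrightarrow> free_at \<phi> i v"
| free_at_parent: "\<lbrakk>free_at \<phi> j v; parent \<phi> i j; v \<notin> bound_vars (subf \<phi> i)\<rbrakk> \<Longrightarrow> free_at \<phi> i v"

lemma free_at_iff: "free_at \<phi> i v \<longleftrightarrow> i \<in> indices \<phi> \<and> v \<in> free (subf \<phi> i)"
proof
  show "i \<in> indices \<phi> \<and> v \<in> free (subf \<phi> i)" if "free_at \<phi> i v"
    using that
  proof induction
    case (free_at_parent j v i)
    moreover from this have "subf \<phi> j \<in> set (children (subf \<phi> i))"
      using set_children_subf parent_in_indices by blast
    ultimately show ?case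
      using parent_in_indices free_iff[of v "subf \<phi> i"] by blast
  qed simp
next
  assume "i \<in> indices \<phi> \<and> v \<in> free (subf \<phi> i)"
  then show "free_at \<phi> i v"
  proof (induction "size (subf \<phi> i)" arbitrary: i rule: less_induct)
    case less
    then consider R vs where "subf \<phi> i = Atom R vs" "v \<in> set vs"
      | j where "parent \<phi> i j" "v \<in> free (subf \<phi> j)" "v \<notin> bound_vars (subf \<phi> i)"
      using free_iff[of v "subf \<phi> i"] set_children_subf[of i \<phi>] by auto
    then show ?case
    proof cases
      case 1
      then show ?thesis using less.prems by (auto intro: free_at_atom)
    next
      case 2
      then have "size (subf \<phi> j) < size (subf \<phi> i)"
        using less.prems set_children_subf size_children by blast
      then show ?thesis
        using less.hyps 2 parent_in_indices free_at_parent by blast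
    qed
  qed
qed

definition atom_vars :: "('v, 's, 'r) qc \<Rightarrow> ('v, 's) var set" where
  "atom_vars \<phi> = {v. \<exists>i\<in>indices \<phi>. \<exists>R vs. subf \<phi> i = Atom R vs \<and> v \<in> set vs}"

lemma free_at_atom_vars: "free_at \<phi> i v \<Longrightarrow> v \<in> atom_vars \<phi>"
  by (induction rule: free_at.induct) (auto simp: atom_vars_def)

lemma free_subset_atom_vars: "i \<in> indices \<phi> \<Longrightarrow> free (subf \<phi> i) \<subseteq> atom_vars \<phi>"
  using free_at_atom_vars free_at_iff by blast

lemma sort_of_atom_vars:
  assumes "qcsp_instance \<phi> B" and "v \<in> atom_vars \<phi>"
  shows "sort_of v \<in> sorts B"
proof -
  obtain i R vs where i: "i \<in> indices \<phi>" "subf \<phi> i = Atom R vs" "v \<in> set vs"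
    using assms(2) unfolding atom_vars_def by blast
  then have "R \<in> symbols B" "map sort_of vs = arity B R"
    using assms(1) well_sorted_subf[of B \<phi> i] by (auto simp: qcsp_instance_def)
  moreover have "is_signature B"
    using assms(1) by (simp add: qcsp_instance_def is_struct_def)
  ultimately show ?thesis
    using i(3) unfolding is_signature_def by (metis image_eqI list.set_map subsetD)
qed

section \<open>Judgement proofs one variable at a time\<close>

lemma maps_dom: "f \<in> maps B V \<Longrightarrow> dom f = V"
  by (simp add: maps_def)

lemma maps_upd: "f \<in> maps B V \<Longrightarrow> b \<in> univ B (sort_of y) \<Longrightarrow> f(y \<mapsto> b) \<in> maps B (insert y V)"
  unfolding maps_def by auto

lemma maps_upd_iff:
  "y \<notin> dom f \<Longrightarrow>
   f(y \<mapsto> b) \<in> maps B (insert y (dom f)) \<longleftrightarrow> f \<in> maps B (dom f) \<and> b \<in> univ B (sort_of y)"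
  unfolding maps_def by (auto split: if_splits)

lemma maps_restrict: "f \<in> maps B V \<Longrightarrow> U \<subseteq> V \<Longrightarrow> f |` U \<in> maps B U"
  unfolding maps_def by (auto simp: dom_def restrict_map_def subset_iff split: if_splits)

lemma restrict_dom: "f |` dom f = f"
  by (auto simp: restrict_map_def dom_def)

abbreviation adjacent :: "('v, 's, 'r) qc \<Rightarrow> index \<Rightarrow> index \<Rightarrow> bool" where
  "adjacent \<phi> i j \<equiv> parent \<phi> i j \<or> parent \<phi> j i"

inductive available :: "nat \<Rightarrow> ('v, 's, 'r) qc \<Rightarrow> index \<Rightarrow> ('v, 's) var set \<Rightarrow> bool"
  for k :: nat and \<phi> :: "('v, 's, 'r) qc" where
  available_atom: "\<lbrakk>i \<in> indices \<phi>; subf \<phi> i = Atom R vs; card (set vs) \<le> k\<rbrakk> \<Longrightarrow>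
    available k \<phi> i (set vs)"
| available_projection: "available k \<phi> i (insert y V) \<Longrightarrow> available k \<phi> i V"
| available_join: "\<lbrakk>available k \<phi> i V; available k \<phi> i {y}; card (insert y V) \<le> k\<rbrakk> \<Longrightarrow>
    available k \<phi> i (insert y V)"
| available_flow: "\<lbrakk>available k \<phi> j V; adjacent \<phi> i j; V \<subseteq> free (subf \<phi> i)\<rbrakk> \<Longrightarrow>
    available k \<phi> i V"

inductive excluded ::
  "nat \<Rightarrow> ('v, 's, 'r) qc \<Rightarrow> ('s, 'r, 'b) struct \<Rightarrow> index \<Rightarrow> (('v, 's) var \<rightharpoonup> 'b) \<Rightarrow> bool"
  for k :: nat and \<phi> :: "('v, 's, 'r) qc" and B :: "('s, 'r, 'b) struct" where
  excluded_atom: "\<lbrakk>i \<in> indices \<phi>; subf \<phi> i = Atom R vs; card (set vs) \<le> k; f \<in> maps B (set vs);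
    map (\<lambda>v. the (f v)) vs \<notin> rel B R\<rbrakk> \<Longrightarrow> excluded k \<phi> B i f"
| excluded_projection: "\<lbrakk>available k \<phi> i (insert y (dom f)); y \<notin> dom f; f \<in> maps B (dom f);
    \<forall>b\<in>univ B (sort_of y). excluded k \<phi> B i (f(y \<mapsto> b))\<rbrakk> \<Longrightarrow> excluded k \<phi> B i f"
| excluded_join: "\<lbrakk>excluded k \<phi> B i f; available k \<phi> i (insert y (dom f)); y \<notin> dom f;
    b \<in> univ B (sort_of y)\<rbrakk> \<Longrightarrow> excluded k \<phi> B i (f(y \<mapsto> b))"
| excluded_flow: "\<lbrakk>excluded k \<phi> B j f; adjacent \<phi> i j; dom f \<subseteq> free (subf \<phi> i)\<rbrakk> \<Longrightarrow>
    excluded k \<phi> B i f"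
| excluded_forall_elim: "\<lbrakk>excluded k \<phi> B j (f(y \<mapsto> b)); y \<notin> dom f;
    subf \<phi> i = Forall y (subf \<phi> j); parent \<phi> i j\<rbrakk> \<Longrightarrow> excluded k \<phi> B i f"

lemma availableD:
  assumes "available k \<phi> i V"
  shows "i \<in> indices \<phi>" and "V \<subseteq> free (subf \<phi> i)" and "card V \<le> k" and "finite V"
proof -
  have "i \<in> indices \<phi> \<and> V \<subseteq> free (subf \<phi> i) \<and> card V \<le> k"
    using assms
  proof induction
    case (available_projection i y V)
    then show ?case
      using card_insert_le[of V y] by simp
  qed (auto simp: parent_def)
  then show "i \<in> indices \<phi>" "V \<subseteq> free (subf \<phi> i)" "card V \<le> k" "finite V"
    using finite_subset[OF _ finite_free] by auto
qed

lemma available_atom_vars: "available k \<phi> i V \<Longrightarrow> V \<subseteq> atom_vars \<phi>"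
  using availableD(1,2) free_subset_atom_vars by blast

lemma available_subset:
  assumes "available k \<phi> i V" and "U \<subseteq> V"
  shows "available k \<phi> i U"
proof -
  have "available k \<phi> i (U \<union> D) \<Longrightarrow> available k \<phi> i U" if "finite D" for D
    using that by (induction D) (auto dest: available_projection)
  moreover have "finite (V - U)" using availableD(4)[OF assms(1)] by simp
  ultimately show ?thesis using assms by (simp add: Un_absorb1)
qed

lemma available_Un:
  assumes V: "available k \<phi> i V" and W: "available k \<phi> i W" and card: "card (V \<union> W) \<le> k"
  shows "available k \<phi> i (V \<union> W)"
proof -
  have fin: "finite V" "finite W" using availableD(4) V W by blast+
  have "available k \<phi> i (V \<union> D)" if "D \<subseteq> W" for D
    using finite_subset[OF that fin(2)] that
  proof (induction D)
    case (insert y D)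
    have "available k \<phi> i {y}" using available_subset[OF W] insert.prems by simp
    moreover have "card (insert y (V \<union> D)) \<le> k"
      using card_mono[of "V \<union> W" "insert y (V \<union> D)"] fin insert.prems card by (auto simp: le_supI2)
    ultimately show ?case using available_join insert by simp
  qed (simp add: V)
  then show ?thesis by blast
qed

lemma excludedD:
  assumes "excluded k \<phi> B i f"
  shows "available k \<phi> i (dom f)" and "f \<in> maps B (dom f)"
proof -
  have "available k \<phi> i (dom f) \<and> f \<in> maps B (dom f)"
    using assms
  proof induction
    case (excluded_atom i R vs f)
    then show ?case using available_atom maps_dom by metis
  next
    case (excluded_projection i y f)
    then show ?case using available_subset by blast
  next
    case (excluded_join i f y b)
    then show ?case using maps_upd[of f B "dom f" b y] by (simp del: fun_upd_apply)
  next
    case (excluded_flow j f i)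
    then show ?case using available_flow by blast
  next
    case (excluded_forall_elim j f y b i)
    then have "available k \<phi> j (dom f)" "f \<in> maps B (dom f)"
      using available_subset[of k \<phi> j "insert y (dom f)"] maps_upd_iff[of y f b B]
      by (auto simp del: fun_upd_apply)
    moreover from this have "dom f \<subseteq> free (subf \<phi> i)"
      using excluded_forall_elim.hyps(2,3) availableD(2) by fastforce
    ultimately show ?case using available_flow excluded_forall_elim.hyps(4) by blast
  qed
  then show "available k \<phi> i (dom f)" "f \<in> maps B (dom f)" by auto
qed

lemma excluded_from_extensions:
  assumes "finite D" and "D \<inter> dom f = {}" and "available k \<phi> i (dom f \<union> D)" and "f \<in> maps B (dom f)"
    and "\<And>g. g \<in> maps B (dom f \<union> D) \<Longrightarrow> g |` dom f = f \<Longrightarrow> excluded k \<phi> B i g"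
  shows "excluded k \<phi> B i f"
  using assms
proof (induction D arbitrary: f)
  case empty
  then show ?case using restrict_dom[of f] by simp
next
  case (insert y D)
  have y: "y \<notin> dom f" using insert.prems by auto
  have "excluded k \<phi> B i (f(y \<mapsto> b))" if b: "b \<in> univ B (sort_of y)" for b
  proof (rule insert.IH)
    show "D \<inter> dom (f(y \<mapsto> b)) = {}" using insert by auto
    show "available k \<phi> i (dom (f(y \<mapsto> b)) \<union> D)" using insert.prems(2) by simp
    show "f(y \<mapsto> b) \<in> maps B (dom (f(y \<mapsto> b)))" using maps_upd[OF insert.prems(3) b] by simp
    fix g assume g: "g \<in> maps B (dom (f(y \<mapsto> b)) \<union> D)" "g |` dom (f(y \<mapsto> b)) = f(y \<mapsto> b)"
    have "g |` dom f = (g |` dom (f(y \<mapsto> b))) |` dom f" by (simp add: inf.absorb2 subset_insertI)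
    also have "\<dots> = f" using y unfolding g(2) by (auto simp: restrict_map_def fun_eq_iff dom_def)
    finally show "excluded k \<phi> B i g" using insert.prems(4) g(1) by simp
  qed
  moreover have "available k \<phi> i (insert y (dom f))"
    by (rule available_subset[OF insert.prems(2)]) auto
  ultimately show ?case using excluded_projection y insert.prems(3) by blast
qed

lemma excluded_from_restriction:
  assumes "excluded k \<phi> B i (f |` U)" and "available k \<phi> i (dom f)" and "f \<in> maps B (dom f)"
  shows "excluded k \<phi> B i f"
proof -
  have "excluded k \<phi> B i (f |` (dom f \<inter> U \<union> D))" if "finite D" "D \<subseteq> dom f - U" for D
    using that
  proof (induction D)
    case empty
    have "f |` (dom f \<inter> U) = f |` U" by (auto simp: restrict_map_def dom_def)
    then show ?case using assms(1) by simp
  next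
    case (insert y D)
    let ?g = "f |` (dom f \<inter> U \<union> D)"
    have dom: "dom ?g = dom f \<inter> U \<union> D" using insert.prems by auto
    obtain b where b: "f y = Some b" using insert.prems by blast
    have "excluded k \<phi> B i (?g(y \<mapsto> b))"
    proof (rule excluded_join)
      show "excluded k \<phi> B i ?g" using insert by simp
      show "available k \<phi> i (insert y (dom ?g))"
        unfolding dom using insert.prems by (intro available_subset[OF assms(2)]) auto
      show "y \<notin> dom ?g" using dom insert by auto
      show "b \<in> univ B (sort_of y)" using assms(3) b unfolding maps_def by force
    qed
    moreover have "?g(y \<mapsto> b) = f |` (dom f \<inter> U \<union> insert y D)"
      using b by (auto simp: restrict_map_def fun_eq_iff)
    ultimately show ?case by simp
  qed
  from this[of "dom f - U"] show ?thesis
    using availableD(4)[OF assms(2)] by (simp add: Int_Diff_Un restrict_dom)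
qed

lemma excluded_empty_root: "excluded k \<phi> B i Map.empty \<Longrightarrow> excluded k \<phi> B [] Map.empty"
proof (induction i rule: rev_induct)
  case (snoc n i)
  then have "parent \<phi> i (i @ [n])"
    using availableD(1)[OF excludedD(1)] parent_iff_snoc by blast
  then have "excluded k \<phi> B i Map.empty" using snoc.prems excluded_flow by fastforce
  then show ?case by (rule snoc.IH)
qed

definition provable ::
  "nat \<Rightarrow> ('v, 's, 'r) qc \<Rightarrow> ('s, 'r, 'b) struct \<Rightarrow> ('v, 's, 'b) judgement set" where
  "provable k \<phi> B = {J. \<exists>Js. judgement_proof \<phi> B Js \<and> proof_width Js \<le> k \<and> J \<in> set Js}"

lemma judge_consistent_iff_provable:
  "judge_consistent k \<phi> B \<longleftrightarrow> (\<forall>J\<in>provable k \<phi> B. \<not> empty_judgement J)"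
  unfolding judge_consistent_def provable_def by blast

lemma proof_width_le_iff: "proof_width Js \<le> k \<longleftrightarrow> (\<forall>J\<in>set Js. width J \<le> k)"
  unfolding proof_width_def by simp

lemma derives_mono: "derives \<phi> B P J \<Longrightarrow> P \<subseteq> Q \<Longrightarrow> derives \<phi> B Q J"
  by (induction rule: derives.induct) (auto intro: derives.intros)

lemma judgement_proof_append:
  assumes "judgement_proof \<phi> B Js" and "judgement_proof \<phi> B Ks"
  shows "judgement_proof \<phi> B (Js @ Ks)"
  unfolding judgement_proof_def
proof (intro allI impI)
  fix n assume n: "n < length (Js @ Ks)"
  show "is_judgement \<phi> B ((Js @ Ks) ! n) \<and> derives \<phi> B (set (take n (Js @ Ks))) ((Js @ Ks) ! n)"
  proof (cases "n < length Js")
    case True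
    then show ?thesis using assms(1) unfolding judgement_proof_def by (simp add: nth_append)
  next
    case False
    then have "n - length Js < length Ks" using n by auto
    then show ?thesis using assms(2) False unfolding judgement_proof_def
      by (auto simp: nth_append intro: derives_mono)
  qed
qed

lemma provable_common_proof:
  assumes "finite P" and "P \<subseteq> provable k \<phi> B"
  shows "\<exists>Js. judgement_proof \<phi> B Js \<and> proof_width Js \<le> k \<and> P \<subseteq> set Js"
  using assms
proof (induction P)
  case empty
  show ?case by (rule exI[of _ "[]"]) (simp add: judgement_proof_def proof_width_def)
next
  case (insert J P)
  then obtain Js Ks where "judgement_proof \<phi> B Js" "proof_width Js \<le> k" "P \<subseteq> set Js"
    "judgement_proof \<phi> B Ks" "proof_width Ks \<le> k" "J \<in> set Ks"
    unfolding provable_def by auto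
  then show ?case
    by (intro exI[of _ "Js @ Ks"]) (auto simp: proof_width_le_iff judgement_proof_append)
qed

lemma provable_derives:
  assumes "derives \<phi> B P J" and "finite P" and "P \<subseteq> provable k \<phi> B"
    and "is_judgement \<phi> B J" and "width J \<le> k"
  shows "J \<in> provable k \<phi> B"
proof -
  obtain Js where Js: "judgement_proof \<phi> B Js" "proof_width Js \<le> k" "P \<subseteq> set Js"
    using provable_common_proof assms by blast
  have "judgement_proof \<phi> B (Js @ [J])"
    using Js assms(4) derives_mono[OF assms(1)] unfolding judgement_proof_def
    by (auto simp: nth_append less_Suc_eq)
  then show ?thesis
    unfolding provable_def using Js assms(5)
    by (auto simp: proof_width_le_iff intro!: exI[of _ "Js @ [J]"])
qed

lemma provable_induct [consumes 1, case_names derives]: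
  assumes "J \<in> provable k \<phi> B"
    and derives: "\<And>P J. derives \<phi> B P J \<Longrightarrow> is_judgement \<phi> B J \<Longrightarrow> width J \<le> k \<Longrightarrow>
      (\<And>I. I \<in> P \<Longrightarrow> Q I) \<Longrightarrow> Q J"
  shows "Q J"
proof -
  obtain Js where Js: "judgement_proof \<phi> B Js" "proof_width Js \<le> k" "J \<in> set Js"
    using assms(1) unfolding provable_def by blast
  have "Q (Js ! n)" if "n < length Js" for n
    using that
  proof (induction n rule: less_induct)
    case (less n)
    have "Q I" if "I \<in> set (take n Js)" for I
      using that less by (auto simp: in_set_conv_nth)
    moreover have "width (Js ! n) \<le> k"
      using Js(2) less.prems by (simp add: proof_width_le_iff)
    ultimately show ?case
      using derives Js(1) less.prems unfolding judgement_proof_def by blast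
  qed
  then show ?thesis using Js(3) by (metis in_set_conv_nth)
qed

lemma provableD:
  assumes "(i, V, F) \<in> provable k \<phi> B"
  shows "i \<in> indices \<phi>" and "V \<subseteq> free (subf \<phi> i)" and "finite V" and "card V \<le> k"
    and "F \<subseteq> maps B V"
proof -
  have "is_judgement \<phi> B (i, V, F) \<and> width (i, V, F) \<le> k"
    using assms by (induction rule: provable_induct) blast
  then show "i \<in> indices \<phi>" "V \<subseteq> free (subf \<phi> i)" "finite V" "card V \<le> k" "F \<subseteq> maps B V"
    using finite_subset[OF _ finite_free] by auto
qed

fun reflected :: "nat \<Rightarrow> ('v, 's, 'r) qc \<Rightarrow> ('s, 'r, 'b) struct \<Rightarrow> ('v, 's, 'b) judgement \<Rightarrow> bool" where
  "reflected k \<phi> B (i, V, F) \<longleftrightarrow> available k \<phi> i V \<and> (\<forall>f\<in>maps B V - F. excluded k \<phi> B i f)"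

lemma reflected_projection:
  assumes "reflected k \<phi> B (i, V, F)" and "U \<subseteq> V"
  shows "reflected k \<phi> B (i, U, restrict_maps F U)"
proof -
  have V: "available k \<phi> i V" "\<forall>f\<in>maps B V - F. excluded k \<phi> B i f"
    using assms(1) by simp_all
  have "excluded k \<phi> B i f" if f: "f \<in> maps B U - restrict_maps F U" for f
  proof (rule excluded_from_extensions[of "V - U"])
    have dom: "dom f = U" using f maps_dom by blast
    then have V_eq: "dom f \<union> (V - U) = V" using assms(2) by blast
    show "finite (V - U)" "(V - U) \<inter> dom f = {}" "f \<in> maps B (dom f)"
      using availableD(4)[OF V(1)] f by (auto simp: dom)
    show "available k \<phi> i (dom f \<union> (V - U))" unfolding V_eq by (rule V(1))
    fix g assume g: "g \<in> maps B (dom f \<union> (V - U))" "g |` dom f = f"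
    then have "g \<notin> F" using f dom unfolding restrict_maps_def by auto
    then show "excluded k \<phi> B i g" using V(2) g(1) unfolding V_eq by blast
  qed
  then show ?thesis using available_subset[OF V(1) assms(2)] by simp
qed

lemma reflected_join:
  assumes "reflected k \<phi> B (i, V, F)" and "reflected k \<phi> B (i, W, G)" and "card (V \<union> W) \<le> k"
  shows "reflected k \<phi> B (i, V \<union> W, join_maps B V F W G)"
proof -
  have available: "available k \<phi> i (V \<union> W)"
    using assms available_Un[of k \<phi> i V W] by simp
  have "excluded k \<phi> B i f" if f: "f \<in> maps B (V \<union> W) - join_maps B V F W G" for f
  proof -
    have "f |` V \<in> maps B V - F \<or> f |` W \<in> maps B W - G"
      using f maps_restrict[of f B "V \<union> W"] unfolding join_maps_def by blast
    then have "excluded k \<phi> B i (f |` V) \<or> excluded k \<phi> B i (f |` W)"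
      using assms(1,2) by auto
    moreover have "dom f = V \<union> W" using f maps_dom by blast
    ultimately show ?thesis
      using excluded_from_restriction[of k \<phi> B i f] available f by auto
  qed
  then show ?thesis using available by simp
qed

lemma reflected_flow:
  assumes "reflected k \<phi> B (j, V, F)" and "adjacent \<phi> i j" and "V \<subseteq> free (subf \<phi> i)"
  shows "reflected k \<phi> B (i, V, F)"
  using assms available_flow excluded_flow maps_dom by (metis DiffD1 reflected.simps)

lemma reflected_forall_elim:
  assumes "reflected k \<phi> B (j, V, F)" and y: "y \<in> V"
    and i: "subf \<phi> i = Forall y (subf \<phi> j)" "parent \<phi> i j"
  shows "reflected k \<phi> B (i, V - {y}, eps_maps B y V F)"
proof -
  have V: "available k \<phi> j V" "\<forall>f\<in>maps B V - F. excluded k \<phi> B j f"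
    using assms(1) by simp_all
  have "V - {y} \<subseteq> free (subf \<phi> i)" using availableD(2)[OF V(1)] i(1) by auto
  then have "available k \<phi> i (V - {y})"
    using available_flow[OF available_subset[OF V(1)]] i(2) by blast
  moreover have "excluded k \<phi> B i f" if f: "f \<in> maps B (V - {y}) - eps_maps B y V F" for f
  proof -
    obtain b where b: "b \<in> univ B (sort_of y)" "f(y \<mapsto> b) \<notin> F"
      using f unfolding eps_maps_def by auto
    have "f(y \<mapsto> b) \<in> maps B V"
      using maps_upd[of f B "V - {y}" b y] f b(1) y by (simp add: insert_absorb)
    then have "excluded k \<phi> B j (f(y \<mapsto> b))" using V(2) b(2) by blast
    moreover have "y \<notin> dom f" using f maps_dom by blast
    ultimately show ?thesis using i by (rule excluded_forall_elim)
  qed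
  ultimately show ?thesis by simp
qed

lemma provable_reflected: "J \<in> provable k \<phi> B \<Longrightarrow> reflected k \<phi> B J"
proof (induction rule: provable_induct)
  case (derives P J)
  from derives.hyps(1) show ?case
  proof cases
    case (atom i R vs)
    then show ?thesis
      using derives.hyps(3) available_atom[of i \<phi> R vs k] excluded_atom[of i \<phi> R vs k _ B] by auto
  next
    case projection
    then show ?thesis using derives.IH reflected_projection by blast
  next
    case join
    then show ?thesis using derives reflected_join by (metis width.simps)
  next
    case forall_elim
    then show ?thesis using derives.IH reflected_forall_elim by blast
  next
    case upward_flow
    then show ?thesis using derives reflected_flow by (metis is_judgement.simps)
  next
    case downward_flow
    then show ?thesis using derives reflected_flow by (metis is_judgement.simps)
  qed
qed

lemma provable_atom:
  assumes "i \<in> indices \<phi>" and "subf \<phi> i = Atom R vs" and "card (set vs) \<le> k"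
  shows "(i, set vs, {f \<in> maps B (set vs). map (\<lambda>v. the (f v)) vs \<in> rel B R}) \<in> provable k \<phi> B"
  using assms by (intro provable_derives[OF derives.atom[where P = "{}"]]) auto

lemma provable_projection:
  assumes V: "(i, V, F) \<in> provable k \<phi> B" and U: "U \<subseteq> V"
  shows "(i, U, restrict_maps F U) \<in> provable k \<phi> B"
proof (rule provable_derives)
  show "derives \<phi> B {(i, V, F)} (i, U, restrict_maps F U)"
    using U by (intro derives.projection) auto
  have "restrict_maps F U \<subseteq> maps B U"
    using provableD(5)[OF V] U maps_restrict unfolding restrict_maps_def by blast
  then show "is_judgement \<phi> B (i, U, restrict_maps F U)"
    using provableD(1,2)[OF V] U by auto
  show "width (i, U, restrict_maps F U) \<le> k"
    using provableD(3,4)[OF V] card_mono[OF _ U] by simp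
qed (use V in auto)

lemma provable_join:
  assumes V: "(i, V, F) \<in> provable k \<phi> B" and W: "(i, W, G) \<in> provable k \<phi> B"
    and "card (V \<union> W) \<le> k"
  shows "(i, V \<union> W, join_maps B V F W G) \<in> provable k \<phi> B"
  using assms provableD(1,2)[OF V] provableD(2)[OF W]
  by (intro provable_derives[OF derives.join[where P = "{(i, V, F), (i, W, G)}"]])
    (auto simp: join_maps_def)

lemma provable_flow:
  assumes j: "(j, V, F) \<in> provable k \<phi> B" and "adjacent \<phi> i j" and "V \<subseteq> free (subf \<phi> i)"
  shows "(i, V, F) \<in> provable k \<phi> B"
proof (rule provable_derives)
  show "derives \<phi> B {(j, V, F)} (i, V, F)"
    using assms(2) derives.upward_flow[of j V F _ \<phi> i B]
      derives.downward_flow[of j V F _ \<phi> i B] by auto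
  show "is_judgement \<phi> B (i, V, F)" "width (i, V, F) \<le> k"
    using assms provableD[OF j] by (auto simp: parent_def)
qed (use j in auto)

lemma provable_forall_elim:
  assumes j: "(j, V, F) \<in> provable k \<phi> B" and "y \<in> V"
    and i: "subf \<phi> i = Forall y (subf \<phi> j)" "parent \<phi> i j"
  shows "(i, V - {y}, eps_maps B y V F) \<in> provable k \<phi> B"
proof (rule provable_derives)
  show "derives \<phi> B {(j, V, F)} (i, V - {y}, eps_maps B y V F)"
    using assms by (intro derives.forall_elim) auto
  show "is_judgement \<phi> B (i, V - {y}, eps_maps B y V F)"
    using provableD(2)[OF j] i by (auto simp: parent_def eps_maps_def)
  show "width (i, V - {y}, eps_maps B y V F) \<le> k"
    using provableD(4)[OF j] card_Diff1_le[of V y] by simp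
qed (use j in auto)

lemma provable_Int:
  assumes F: "(i, V, F) \<in> provable k \<phi> B" and G: "(i, V, G) \<in> provable k \<phi> B"
  shows "(i, V, F \<inter> G) \<in> provable k \<phi> B"
proof -
  have "f |` V = f" if "f \<in> maps B V" for f
    using restrict_dom[of f] maps_dom[OF that] by simp
  then have "join_maps B V F V G = F \<inter> G"
    using provableD(5)[OF F] unfolding join_maps_def by (auto simp: subset_iff)
  then show ?thesis
    using provable_join[OF F G] provableD(4)[OF F] by simp
qed

lemma available_provable: "available k \<phi> i V \<Longrightarrow> \<exists>F. (i, V, F) \<in> provable k \<phi> B"
proof (induction rule: available.induct)
  case (available_atom i R vs)
  show ?case by (rule exI, rule provable_atom[OF available_atom])
next
  case (available_projection i y V)
  then show ?case using provable_projection by blast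
next
  case (available_join i V y)
  then show ?case using provable_join[of i "{y}" _ k \<phi> B V] by auto
qed (use provable_flow in blast)

definition refuted ::
  "nat \<Rightarrow> ('v, 's, 'r) qc \<Rightarrow> ('s, 'r, 'b) struct \<Rightarrow> index \<Rightarrow> (('v, 's) var \<rightharpoonup> 'b) \<Rightarrow> bool" where
  "refuted k \<phi> B i f \<longleftrightarrow> (\<exists>F. (i, dom f, F) \<in> provable k \<phi> B \<and> f \<notin> F)"

lemma refutedI: "(i, V, F) \<in> provable k \<phi> B \<Longrightarrow> dom f = V \<Longrightarrow> f \<notin> F \<Longrightarrow> refuted k \<phi> B i f"
  unfolding refuted_def by blast

lemma refuted_simultaneously:
  assumes "finite A" and "available k \<phi> i V"
    and "\<And>f. f \<in> A \<Longrightarrow> dom f = V \<and> refuted k \<phi> B i f"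
  shows "\<exists>F. (i, V, F) \<in> provable k \<phi> B \<and> F \<inter> A = {}"
  using assms(1,3)
proof (induction A)
  case empty
  then show ?case using available_provable[OF assms(2)] by blast
next
  case (insert f A)
  then obtain F where F: "(i, V, F) \<in> provable k \<phi> B" "F \<inter> A = {}" by blast
  obtain G where G: "(i, V, G) \<in> provable k \<phi> B" "f \<notin> G"
    using insert.prems[of f] unfolding refuted_def by blast
  show ?case
    using provable_Int[OF F(1) G(1)] F(2) G(2) by (intro exI[of _ "F \<inter> G"]) auto
qed

lemma maps_insert_restrictD:
  assumes "g \<in> maps B (insert y (dom f))" and "g |` dom f = f" and "y \<notin> dom f"
  shows "\<exists>b\<in>univ B (sort_of y). g = f(y \<mapsto> b)"
proof -
  obtain b where b: "g y = Some b" "b \<in> univ B (sort_of y)"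
    using assms(1) unfolding maps_def by force
  have "g |` insert y (dom f) = (g |` dom f)(y := g y)"
    by (auto simp: restrict_map_def)
  moreover have "g |` insert y (dom f) = g"
    using restrict_dom[of g] maps_dom[OF assms(1)] by simp
  ultimately show ?thesis using b assms(2) by auto
qed

lemma refuted_projection:
  assumes "finite (univ B (sort_of y))" and available: "available k \<phi> i (insert y (dom f))"
    and y: "y \<notin> dom f" and refuted: "\<And>b. b \<in> univ B (sort_of y) \<Longrightarrow> refuted k \<phi> B i (f(y \<mapsto> b))"
  shows "refuted k \<phi> B i f"
proof -
  let ?extensions = "(\<lambda>b. f(y \<mapsto> b)) ` univ B (sort_of y)"
  have "\<exists>F. (i, insert y (dom f), F) \<in> provable k \<phi> B \<and> F \<inter> ?extensions = {}"
    by (rule refuted_simultaneously[OF _ available]) (use assms(1) refuted in auto)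
  then obtain F where F: "(i, insert y (dom f), F) \<in> provable k \<phi> B" "F \<inter> ?extensions = {}"
    by blast
  have "(i, dom f, restrict_maps F (dom f)) \<in> provable k \<phi> B"
    using F(1) by (rule provable_projection) blast
  moreover have "f \<notin> restrict_maps F (dom f)"
  proof
    assume "f \<in> restrict_maps F (dom f)"
    then obtain g where g: "g \<in> F" "g |` dom f = f" unfolding restrict_maps_def by auto
    then have "g \<in> ?extensions"
      using maps_insert_restrictD[OF _ g(2) y] provableD(5)[OF F(1)] by blast
    then show False using F(2) g(1) by blast
  qed
  ultimately show ?thesis by (intro refutedI) auto
qed

lemma refuted_join:
  assumes "refuted k \<phi> B i f" and available: "available k \<phi> i (insert y (dom f))" and y: "y \<notin> dom f"
  shows "refuted k \<phi> B i (f(y \<mapsto> b))"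
proof -
  obtain F where F: "(i, dom f, F) \<in> provable k \<phi> B" "f \<notin> F"
    using assms(1) unfolding refuted_def by blast
  obtain G where G: "(i, insert y (dom f), G) \<in> provable k \<phi> B"
    using available_provable[OF available] by blast
  have "card (dom f \<union> insert y (dom f)) \<le> k" using provableD(4)[OF G] by simp
  from provable_join[OF F(1) G this] show ?thesis
  proof (rule refutedI)
    have "(f(y \<mapsto> b)) |` dom f = f"
      using y by (auto simp: restrict_map_def fun_eq_iff dom_def)
    then show "f(y \<mapsto> b) \<notin> join_maps B (dom f) F (insert y (dom f)) G"
      using F(2) unfolding join_maps_def by simp
  qed auto
qed

lemma refuted_forall_elim:
  assumes "refuted k \<phi> B j (f(y \<mapsto> b))" and b: "b \<in> univ B (sort_of y)" and y: "y \<notin> dom f"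
    and i: "subf \<phi> i = Forall y (subf \<phi> j)" "parent \<phi> i j"
  shows "refuted k \<phi> B i f"
proof -
  obtain F where F: "(j, insert y (dom f), F) \<in> provable k \<phi> B" "f(y \<mapsto> b) \<notin> F"
    using assms(1) by (auto simp: refuted_def simp del: fun_upd_apply)
  from provable_forall_elim[OF F(1) insertI1 i] show ?thesis
  proof (rule refutedI)
    show "f \<notin> eps_maps B y (insert y (dom f)) F"
      using F(2) b unfolding eps_maps_def by blast
  qed (use y in simp)
qed

lemma excluded_refuted:
  assumes "\<And>v. v \<in> atom_vars \<phi> \<Longrightarrow> finite (univ B (sort_of v))"
  shows "excluded k \<phi> B i f \<Longrightarrow> refuted k \<phi> B i f"
proof (induction rule: excluded.induct)
  case (excluded_atom i R vs f)
  show ?case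
    by (rule refutedI[OF provable_atom[OF excluded_atom(1-3)] maps_dom[OF excluded_atom(4)]])
      (simp add: excluded_atom(5))
next
  case (excluded_projection i y f)
  have "y \<in> atom_vars \<phi>" using available_atom_vars[OF excluded_projection.hyps(1)] by simp
  then have "finite (univ B (sort_of y))" by (rule assms)
  then show ?case
    using excluded_projection.hyps(1,2)
    by (rule refuted_projection) (use excluded_projection.IH in blast)
next
  case (excluded_join i f y b)
  show ?case by (rule refuted_join[OF excluded_join.IH excluded_join.hyps(2,3)])
next
  case (excluded_flow j f i)
  then show ?case using provable_flow unfolding refuted_def by blast
next
  case (excluded_forall_elim j f y b i)
  have "b \<in> univ B (sort_of y)"
    using excludedD(2)[OF excluded_forall_elim.hyps(1)]
      maps_upd_iff[OF excluded_forall_elim.hyps(2), of b B]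
    by (simp del: fun_upd_apply)
  then show ?case
    using refuted_forall_elim[OF excluded_forall_elim.IH] excluded_forall_elim.hyps(2-4) by blast
qed

lemma judge_consistent_iff_not_excluded:
  assumes "qcsp_instance \<phi> B" and "finite_struct B"
  shows "judge_consistent k \<phi> B \<longleftrightarrow> \<not> excluded k \<phi> B [] Map.empty"
proof
  assume consistent: "judge_consistent k \<phi> B"
  show "\<not> excluded k \<phi> B [] Map.empty"
  proof
    assume "excluded k \<phi> B [] Map.empty"
    moreover have "finite (univ B (sort_of v))" if "v \<in> atom_vars \<phi>" for v
      using assms(2) sort_of_atom_vars[OF assms(1) that] by (simp add: finite_struct_def)
    ultimately obtain F where F: "([], {}, F) \<in> provable k \<phi> B" "Map.empty \<notin> F"
      using excluded_refuted unfolding refuted_def by fastforce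
    have "F \<subseteq> {Map.empty}" using provableD(5)[OF F(1)] by (auto simp: maps_def)
    then have "empty_judgement ([], {}, F)" using F(2) by auto
    then show False using F(1) consistent by (auto simp: judge_consistent_iff_provable)
  qed
next
  assume root: "\<not> excluded k \<phi> B [] Map.empty"
  have "F \<noteq> {}" if "(i, V, F) \<in> provable k \<phi> B" for i V F
  proof
    assume "F = {}"
    then have "reflected k \<phi> B (i, {}, {})"
      using reflected_projection[OF provable_reflected[OF that], of "{}"]
      by (simp add: restrict_maps_def)
    then have "excluded k \<phi> B i Map.empty" by (simp add: maps_def)
    then show False using excluded_empty_root root by blast
  qed
  then show "judge_consistent k \<phi> B"
    unfolding judge_consistent_iff_provable by auto
qed

section \<open>The saturation algorithm\<close>

text \<open>The value of an absent key is \<open>Leaf\<close>, because \<open>left Leaf = Leaf\<close>.\<close>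

definition lookup :: "tree list \<Rightarrow> tree \<Rightarrow> tree" where
  "lookup es key = left (tree_of_list (map right (filter (\<lambda>e. left e = key) es)))"

lemma lookup_eqI:
  assumes "e \<in> set es" and "\<And>d. d \<in> set es \<Longrightarrow> left d = left e \<Longrightarrow> right d = right e"
  shows "lookup es (left e) = right e"
proof -
  have "e \<in> set (filter (\<lambda>d. left d = left e) es)" using assms(1) by simp
  then obtain d ds where d: "filter (\<lambda>d. left d = left e) es = d # ds"
    by (metis list.exhaust list.set(1) equals0D)
  then have "d \<in> set (filter (\<lambda>d. left d = left e) es)" by simp
  then have "right d = right e" using assms(2) by simp
  then show ?thesis unfolding lookup_def d by simp
qed

lemma poly_time_lookup:
  assumes "poly_time_list L" and "poly_time f"
  shows "poly_time (\<lambda>z. lookup (L z) (f z))"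
  unfolding lookup_def by (intro poly_time_intros assms assms(2)[THEN poly_time_comp])

definition unary :: "nat \<Rightarrow> tree" where
  "unary n = tree_of_list (replicate n Leaf)"

lemma unary_eq_iff [simp]: "unary m = unary n \<longleftrightarrow> m = n"
  unfolding unary_def by (metis length_replicate tree_of_list_eq_iff)

lemma tsize_unary: "tsize (unary n) = 2 * n + 1"
  by (induction n) (simp_all add: unary_def)

definition numbered :: "tree list \<Rightarrow> tree list" where
  "numbered cs = map (\<lambda>(n, c). Node (unary n) c) (List.enumerate 0 cs)"

lemma set_numbered: "set (numbered cs) = (\<lambda>n. Node (unary n) (cs ! n)) ` {..<length cs}"
  by (auto simp: numbered_def in_set_enumerate_eq image_iff)

lemma map_right_numbered: "map right (numbered cs) = cs"
proof -
  have "map right (numbered cs) = map snd (List.enumerate 0 cs)"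
    by (simp add: numbered_def split_beta comp_def)
  then show ?thesis by simp
qed

lemma poly_time_list_numbered:
  assumes L: "poly_time_list L"
  shows "poly_time_list (\<lambda>x. numbered (L x))"
proof -
  let ?g = "\<lambda>a c. Node (Node Leaf (left a)) (Node (Node (left a) c) (right a))"
  have fold: "foldl ?g (Node Leaf Leaf) cs =
      Node (unary (length cs)) (tree_of_list (rev (numbered cs)))" for cs
    by (induction cs rule: rev_induct) (simp_all add: numbered_def unary_def enumerate_append_eq)
  let ?M = "\<lambda>x. 2 * length (L x) + tsize (tree_of_list (L x)) + 2"
  let ?Q = "\<lambda>x. 2 * length (L x) + 1 + (1 + length (L x) * (?M x + 1)) + 1"
  have "poly_time (\<lambda>x. foldl ?g (Node Leaf Leaf) (L x))"
  proof (rule poly_time_foldl[OF L poly_time_const])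
    show "poly_bounded ?Q"
      by (intro poly_bounded_intros poly_bounded_length poly_bounded_tsize_poly_time
          poly_time_tree_of_list L)
    show "tsize (foldl ?g (Node Leaf Leaf) (take n (L x))) \<le> ?Q x" if n: "n \<le> length (L x)" for x n
    proof -
      have "tsize (tree_of_list (rev (numbered (take n (L x))))) \<le> 1 + length (L x) * (?M x + 1)"
      proof (rule tsize_tree_of_list_le)
        show "tsize e \<le> ?M x" if e: "e \<in> set (rev (numbered (take n (L x))))" for e
        proof -
          obtain m where m: "m < n" "e = Node (unary m) (L x ! m)"
            using e n by (auto simp: set_numbered)
          then have "tsize (L x ! m) \<le> tsize (tree_of_list (L x))"
            using n by (intro tsize_le_tree_of_list) simp
          then show ?thesis using m n by (simp add: tsize_unary)
        qed
      qed (simp add: numbered_def n)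
      then show ?thesis using n unfolding fold by (simp add: tsize_unary min_absorb2)
    qed
  qed (intro poly_time_intros)
  then have "poly_time_list (\<lambda>x. rev (list_of_tree (right (foldl ?g (Node Leaf Leaf) (L x)))))"
    by (intro poly_time_list_rev poly_time_intros)
  then show ?thesis by (simp add: fold)
qed

definition is_atom :: "tree \<Rightarrow> bool" where
  "is_atom t \<longleftrightarrow> left t = enc_tag False False"

definition is_forall :: "tree \<Rightarrow> bool" where
  "is_forall t \<longleftrightarrow> left t = enc_tag True False"

definition atom_symbol :: "tree \<Rightarrow> tree" where
  "atom_symbol t = left (right t)"

definition atom_args :: "tree \<Rightarrow> tree list" where
  "atom_args t = (if is_atom t then list_of_tree (right (right t)) else [])"

definition quantified_vars :: "tree \<Rightarrow> tree list" where
  "quantified_vars t = (if is_forall t \<or> left t = enc_tag True True then [left (right t)] else [])"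

definition child_codes :: "tree \<Rightarrow> tree list" where
  "child_codes t = (if left t = enc_tag False True then list_of_tree (right t)
     else if quantified_vars t \<noteq> [] then [right (right t)] else [])"

text \<open>An entry of a level is a pair of the path to an occurrence and its formula. Paths are stored
  from the leaf to the root, so that the parent of a path is its right subtree.\<close>

definition next_level :: "tree list \<Rightarrow> tree list" where
  "next_level es = concat (map (\<lambda>e. map (\<lambda>c. Node (Node (left c) (left e)) (right c))
     (numbered (child_codes (right e)))) es)"

definition level :: "tree \<Rightarrow> nat \<Rightarrow> tree list" where
  "level t n = (next_level ^^ n) [Node Leaf t]"

definition depth :: "tree \<Rightarrow> nat" where
  "depth t = (LEAST n. level t n = [])"

definition occurrences :: "tree \<Rightarrow> tree list" where
  "occurrences t = concat (map (level t) [0..<depth t])"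

definition formula_at :: "tree \<Rightarrow> tree \<Rightarrow> tree" where
  "formula_at x p = lookup (occurrences (left x)) p"

definition child_paths :: "tree \<Rightarrow> tree \<Rightarrow> tree list" where
  "child_paths x p = filter (\<lambda>q. q \<noteq> Leaf \<and> right q = p) (map left (occurrences (left x)))"

definition adjacent_paths :: "tree \<Rightarrow> tree \<Rightarrow> tree list" where
  "adjacent_paths x p = child_paths x p @ (if p = Leaf then [] else [right p])"

definition vars :: "tree \<Rightarrow> tree list" where
  "vars x = concat (map (\<lambda>e. atom_args (right e)) (occurrences (left x)))"

definition elements :: "tree \<Rightarrow> tree \<Rightarrow> tree list" where
  "elements x v = list_of_tree (lookup (list_of_tree (left (right x))) (right v))"

definition bindings :: "tree \<Rightarrow> tree list" where
  "bindings x = concat (map (\<lambda>v. map (\<lambda>b. Node v b) (elements x v)) (vars x))"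

definition tuples :: "tree \<Rightarrow> tree \<Rightarrow> tree list" where
  "tuples x R = list_of_tree (right (lookup (list_of_tree (right (right x))) R))"

primrec short_lists :: "nat \<Rightarrow> tree list \<Rightarrow> tree list" where
  "short_lists 0 L = [Leaf]"
| "short_lists (Suc k) L = Leaf # concat (map (\<lambda>e. map (\<lambda>l. Node e l) (short_lists k L)) L)"

text \<open>A fact consists of a tag, a path and a list that stands for the set of its members, which are
  variables for the tags \<open>free_tag\<close> and \<open>available_tag\<close>, and variable-value pairs for
  \<open>excluded_tag\<close>.\<close>

definition free_tag :: tree where "free_tag = Leaf"
definition available_tag :: tree where "available_tag = Node Leaf Leaf"
definition excluded_tag :: tree where "excluded_tag = Node Leaf (Node Leaf Leaf)"

lemma tags_distinct [simp]:
  "free_tag \<noteq> available_tag" "free_tag \<noteq> excluded_tag" "available_tag \<noteq> excluded_tag"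
  "available_tag \<noteq> free_tag" "excluded_tag \<noteq> free_tag" "excluded_tag \<noteq> available_tag"
  by (simp_all add: free_tag_def available_tag_def excluded_tag_def)

definition fact_tree :: "tree \<Rightarrow> tree \<Rightarrow> tree list \<Rightarrow> tree" where
  "fact_tree tag p l = Node tag (Node p (tree_of_list l))"

definition fact_members :: "tree \<Rightarrow> tree list" where
  "fact_members w = list_of_tree (right (right w))"

type_synonym content = "tree \<times> tree \<times> tree set"

definition fact_content :: "tree \<Rightarrow> content" where
  "fact_content w = (left w, left (right w), set (fact_members w))"

definition known :: "tree list \<Rightarrow> tree \<Rightarrow> tree \<Rightarrow> tree list \<Rightarrow> bool" where
  "known S tag p l \<longleftrightarrow> (tag, p, set l) \<in> fact_content ` set S"

definition candidates :: "nat \<Rightarrow> tree \<Rightarrow> tree list" where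
  "candidates k x = concat (map (\<lambda>p.
     map (\<lambda>v. fact_tree free_tag p [v]) (vars x) @
     map (\<lambda>l. fact_tree available_tag p (list_of_tree l)) (short_lists k (vars x)) @
     map (\<lambda>l. fact_tree excluded_tag p (list_of_tree l))
       (filter (\<lambda>l. inj_on left (set (list_of_tree l))) (short_lists k (bindings x))))
     (map left (occurrences (left x))))"

definition free_rule :: "tree \<Rightarrow> tree list \<Rightarrow> tree \<Rightarrow> tree \<Rightarrow> bool" where
  "free_rule x S p v \<longleftrightarrow> v \<in> set (atom_args (formula_at x p)) \<or>
     v \<notin> set (quantified_vars (formula_at x p)) \<and>
       (\<exists>q\<in>set (child_paths x p). known S free_tag q [v])"

definition available_rule :: "tree \<Rightarrow> tree list \<Rightarrow> tree \<Rightarrow> tree list \<Rightarrow> bool" where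
  "available_rule x S p l \<longleftrightarrow>
     is_atom (formula_at x p) \<and> set l = set (atom_args (formula_at x p)) \<or>
     (\<exists>y\<in>set (vars x). known S available_tag p (y # l)) \<or>
     (\<exists>y\<in>set l. known S available_tag p (filter (\<lambda>v. v \<noteq> y) l) \<and> known S available_tag p [y]) \<or>
     (\<forall>v\<in>set l. known S free_tag p [v]) \<and> (\<exists>q\<in>set (adjacent_paths x p). known S available_tag q l)"

definition violates_atom :: "tree \<Rightarrow> tree \<Rightarrow> tree list \<Rightarrow> bool" where
  "violates_atom x t l \<longleftrightarrow> is_atom t \<and> set (map left l) = set (atom_args t) \<and>
     tree_of_list (map (\<lambda>v. lookup l v) (atom_args t)) \<notin> set (tuples x (atom_symbol t))"

definition excluded_projection_rule :: "tree \<Rightarrow> tree list \<Rightarrow> tree \<Rightarrow> tree list \<Rightarrow> bool" where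
  "excluded_projection_rule x S p l \<longleftrightarrow>
     (\<exists>y\<in>set (vars x). y \<notin> set (map left l) \<and> known S available_tag p (y # map left l) \<and>
       (\<forall>b\<in>set (elements x y). known S excluded_tag p (Node y b # l)))"

definition excluded_join_rule :: "tree list \<Rightarrow> tree \<Rightarrow> tree list \<Rightarrow> bool" where
  "excluded_join_rule S p l \<longleftrightarrow> known S available_tag p (map left l) \<and>
     (\<exists>a\<in>set l. known S excluded_tag p (filter (\<lambda>c. c \<noteq> a) l))"

definition excluded_forall_rule :: "tree \<Rightarrow> tree list \<Rightarrow> tree \<Rightarrow> tree list \<Rightarrow> bool" where
  "excluded_forall_rule x S p l \<longleftrightarrow> is_forall (formula_at x p) \<and>
     (\<exists>y\<in>set (quantified_vars (formula_at x p)). y \<notin> set (map left l) \<and>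
       (\<exists>q\<in>set (child_paths x p). \<exists>b\<in>set (elements x y). known S excluded_tag q (Node y b # l)))"

definition excluded_rule :: "tree \<Rightarrow> tree list \<Rightarrow> tree \<Rightarrow> tree list \<Rightarrow> bool" where
  "excluded_rule x S p l \<longleftrightarrow> violates_atom x (formula_at x p) l \<or>
     excluded_projection_rule x S p l \<or> excluded_join_rule S p l \<or>
     (\<forall>v\<in>set (map left l). known S free_tag p [v]) \<and>
       (\<exists>q\<in>set (adjacent_paths x p). known S excluded_tag q l) \<or>
     excluded_forall_rule x S p l"

definition fact_rule :: "tree \<Rightarrow> tree list \<Rightarrow> tree \<Rightarrow> bool" where
  "fact_rule x S u \<longleftrightarrow>
     left u = free_tag \<and> (\<exists>v\<in>set (fact_members u). free_rule x S (left (right u)) v) \<or>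
     left u = available_tag \<and> available_rule x S (left (right u)) (fact_members u) \<or>
     left u = excluded_tag \<and> excluded_rule x S (left (right u)) (fact_members u)"

definition saturate :: "nat \<Rightarrow> tree \<Rightarrow> tree list" where
  "saturate k x = saturation (candidates k x) (fact_rule x)"

section \<open>Running time of the algorithm\<close>

lemma tsize_pos: "0 < tsize t"
  by (cases t) simp_all

lemma sum_tsize_list_of_tree: "(\<Sum>c\<leftarrow>list_of_tree t. tsize c) < tsize t"
  by (induction t) auto

lemma sum_tsize_child_codes: "(\<Sum>c\<leftarrow>child_codes t. tsize c) < tsize t"
proof (cases t)
  case Leaf
  then show ?thesis by (simp add: child_codes_def quantified_vars_def is_forall_def enc_tag_def)
next
  case (Node l r)
  have "tsize (right r) \<le> tsize r" by (cases r) simp_all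
  then show ?thesis
    using sum_tsize_list_of_tree[of r] Node by (simp add: child_codes_def)
qed

definition weight :: "tree list \<Rightarrow> nat" where
  "weight es = (\<Sum>e\<leftarrow>es. tsize (right e))"

lemma weight_next_level: "weight (next_level es) + length es \<le> weight es"
proof (induction es)
  case (Cons e es)
  have "weight (map (\<lambda>c. Node (Node (left c) (left e)) (right c)) (numbered cs)) =
      (\<Sum>c\<leftarrow>cs. tsize c)" for cs
    using arg_cong[OF map_right_numbered[of cs], of "\<lambda>l. sum_list (map tsize l)"]
    by (simp add: weight_def comp_def)
  then show ?case
    using Cons sum_tsize_child_codes[of "right e"] by (simp add: next_level_def weight_def)
qed (simp add: next_level_def)

lemma level_empty_or_weight_le: "level t n = [] \<or> weight (level t n) + n \<le> tsize t"
proof (induction n)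
  case (Suc n)
  have Suc_level: "level t (Suc n) = next_level (level t n)" by (simp add: level_def)
  show ?case
  proof (cases "level t n")
    case Nil
    then show ?thesis by (simp add: Suc_level next_level_def)
  next
    case Cons
    then have "1 \<le> length (level t n)" by simp
    then show ?thesis using Suc Cons weight_next_level[of "level t n"] unfolding Suc_level by auto
  qed
qed (simp add: level_def weight_def)

lemma weight_level_le: "weight (level t n) \<le> tsize t"
  using level_empty_or_weight_le[of t n] by (auto simp: weight_def)

lemma tsize_le_weight: "e \<in> set es \<Longrightarrow> tsize (right e) \<le> weight es"
  unfolding weight_def by (rule member_le_sum_list) auto

lemma length_le_weight: "length es \<le> weight es"
proof (induction es)
  case (Cons e es)
  then show ?case using tsize_pos[of "right e"] by (simp add: weight_def)
qed simp

lemma level_depth: "level t (depth t) = []"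
  and depth_le_tsize: "depth t \<le> tsize t + 1"
proof -
  have "level t (tsize t + 1) = []" using level_empty_or_weight_le[of t "tsize t + 1"] by auto
  then show "level t (depth t) = []" "depth t \<le> tsize t + 1"
    unfolding depth_def by (rule LeastI, rule Least_le)
qed

lemma tsize_level_path_le: "e \<in> set (level t n) \<Longrightarrow> tsize (left e) \<le> 1 + n * (2 * tsize t + 2)"
proof (induction n arbitrary: e)
  case (Suc n)
  then obtain d m where d: "d \<in> set (level t n)" "m < length (child_codes (right d))"
    "left e = Node (unary m) (left d)"
    by (auto simp: level_def next_level_def set_numbered)
  have "length cs \<le> (\<Sum>c\<leftarrow>cs. tsize c)" for cs
    using length_le_weight[of "map (Node Leaf) cs"] by (simp add: weight_def comp_def)
  then have "m < tsize (right d)"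
    using d(2) sum_tsize_child_codes[of "right d"] by (meson less_le_trans less_trans)
  also have "\<dots> \<le> tsize t"
    using tsize_le_weight[OF d(1)] weight_level_le by (rule order_trans)
  finally show ?case using Suc.IH[OF d(1)] d(3) by (simp add: tsize_unary)
qed (simp add: level_def)

definition entry_bound :: "tree \<Rightarrow> nat" where
  "entry_bound t = (tsize t + 1) * (2 * tsize t + 2) + tsize t + 2"

lemma poly_bounded_entry_bound: "poly_bounded entry_bound"
  unfolding entry_bound_def[abs_def] by (intro poly_bounded_intros)

lemma tsize_level_entry_le:
  assumes "e \<in> set (level t n)" and "n \<le> tsize t + 1"
  shows "tsize e \<le> entry_bound t"
proof -
  have "n * (2 * tsize t + 2) \<le> (tsize t + 1) * (2 * tsize t + 2)"
    using assms(2) by (rule mult_le_mono1)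
  moreover have "tsize (right e) \<le> tsize t"
    using tsize_le_weight[OF assms(1)] weight_level_le by (rule order_trans)
  moreover have "tsize e \<le> tsize (left e) + tsize (right e) + 1" by (cases e) simp_all
  ultimately show ?thesis
    using tsize_level_path_le[OF assms(1)] unfolding entry_bound_def by linarith
qed

lemma tsize_level_le:
  assumes "n \<le> tsize t + 1"
  shows "tsize (tree_of_list (level t n)) \<le> 1 + tsize t * (entry_bound t + 1)"
  by (rule tsize_tree_of_list_le)
    (use tsize_level_entry_le assms order_trans[OF length_le_weight weight_level_le] in blast)+

lemma tsize_concat_levels_le:
  assumes "n \<le> tsize t + 1"
  shows "tsize (tree_of_list (concat (map (level t) [0..<n]))) \<le>
    1 + (tsize t + 1) * tsize t * (entry_bound t + 1)"
proof (rule tsize_tree_of_list_le)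
  fix e assume "e \<in> set (concat (map (level t) [0..<n]))"
  then obtain m where "m < n" "e \<in> set (level t m)" by auto
  then show "tsize e \<le> entry_bound t" using tsize_level_entry_le assms by simp
next
  have "length (concat (map (level t) [0..<n])) \<le> (\<Sum>m\<leftarrow>[0..<n]. tsize t)"
    unfolding length_concat map_map comp_def
    by (intro sum_list_mono order_trans[OF length_le_weight weight_level_le])
  also have "\<dots> = n * tsize t" by (simp add: sum_list_triv)
  also have "\<dots> \<le> (tsize t + 1) * tsize t" using assms by (rule mult_le_mono1)
  finally show "length (concat (map (level t) [0..<n])) \<le> (tsize t + 1) * tsize t" .
qed

lemma poly_time_pred_is_atom: "poly_time f \<Longrightarrow> poly_time_pred (\<lambda>z. is_atom (f z))"
  unfolding is_atom_def by (intro poly_time_intros)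

lemma poly_time_pred_is_forall: "poly_time f \<Longrightarrow> poly_time_pred (\<lambda>z. is_forall (f z))"
  unfolding is_forall_def by (intro poly_time_intros)

lemma poly_time_atom_symbol: "poly_time f \<Longrightarrow> poly_time (\<lambda>z. atom_symbol (f z))"
  unfolding atom_symbol_def by (intro poly_time_intros)

lemma poly_time_list_atom_args: "poly_time f \<Longrightarrow> poly_time_list (\<lambda>z. atom_args (f z))"
  unfolding atom_args_def by (intro poly_time_intros poly_time_pred_is_atom)

lemma poly_time_list_quantified_vars: "poly_time f \<Longrightarrow> poly_time_list (\<lambda>z. quantified_vars (f z))"
  unfolding quantified_vars_def by (intro poly_time_intros poly_time_pred_is_forall)

lemma poly_time_list_child_codes: "poly_time f \<Longrightarrow> poly_time_list (\<lambda>z. child_codes (f z))"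
  unfolding child_codes_def tree_of_list_eq_iff[symmetric]
  by (intro poly_time_intros poly_time_list_quantified_vars)

lemma poly_time_list_next_level:
  assumes "poly_time_list L"
  shows "poly_time_list (\<lambda>z. next_level (L z))"
  unfolding next_level_def
  by (intro poly_time_intros poly_time_list_numbered poly_time_list_child_codes assms)

lemma poly_time_list_occurrences:
  assumes "poly_time f"
  shows "poly_time_list (\<lambda>z. occurrences (f z))"
proof -
  let ?init = "\<lambda>t. Node (tree_of_list [Node Leaf t]) Leaf"
  let ?step = "\<lambda>z. Node (tree_of_list (next_level (list_of_tree (left z))))
    (tree_of_list (list_of_tree (right z) @ list_of_tree (left z)))"
  have iterate: "(?step ^^ n) (?init t) =
      Node (tree_of_list (level t n)) (tree_of_list (concat (map (level t) [0..<n])))" for n t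
    by (induction n) (simp_all add: level_def)
  let ?Q = "\<lambda>t. 1 + tsize t * (entry_bound t + 1) +
    (1 + (tsize t + 1) * tsize t * (entry_bound t + 1)) + tsize t + 1"
  have "poly_time (\<lambda>t. (?step ^^ depth t) (?init t))"
  proof (rule poly_time_while[where Q = ?Q])
    show "poly_bounded ?Q" by (intro poly_bounded_intros poly_bounded_entry_bound)
    show "depth t \<le> ?Q t" for t using depth_le_tsize[of t] by linarith
    show "tsize ((?step ^^ n) (?init t)) \<le> ?Q t" if "n \<le> depth t" for t n
      using tsize_level_le[of n t] tsize_concat_levels_le[of n t] that depth_le_tsize[of t]
      unfolding iterate by simp
    show "left ((?step ^^ n) (?init t)) \<noteq> Leaf" if "n < depth t" for t n
      using not_less_Least[OF that[unfolded depth_def]] unfolding iterate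
      by (metis left.simps(2) tree_of_list.simps(1) tree_of_list_eq_iff)
    show "left ((?step ^^ depth t) (?init t)) = Leaf" for t
      unfolding iterate by (simp add: level_depth)
  qed (intro poly_time_intros poly_time_list_next_level)+
  then have "poly_time_list (\<lambda>t. list_of_tree (right ((?step ^^ depth t) (?init t))))"
    by (intro poly_time_intros)
  then have "poly_time_list occurrences"
    unfolding iterate by (simp add: occurrences_def[abs_def])
  then show ?thesis using assms by (rule poly_time_list_comp)
qed

lemma poly_time_formula_at:
  "poly_time x \<Longrightarrow> poly_time p \<Longrightarrow> poly_time (\<lambda>z. formula_at (x z) (p z))"
  unfolding formula_at_def by (intro poly_time_lookup poly_time_list_occurrences poly_time_left)

lemma poly_time_list_child_paths:
  assumes "poly_time x" and "poly_time p"
  shows "poly_time_list (\<lambda>z. child_paths (x z) (p z))"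
  unfolding child_paths_def
  by (intro poly_time_intros poly_time_list_occurrences assms assms(2)[THEN poly_time_comp])

lemma poly_time_list_adjacent_paths:
  "poly_time x \<Longrightarrow> poly_time p \<Longrightarrow> poly_time_list (\<lambda>z. adjacent_paths (x z) (p z))"
  unfolding adjacent_paths_def by (intro poly_time_intros poly_time_list_child_paths)

lemma poly_time_list_vars: "poly_time x \<Longrightarrow> poly_time_list (\<lambda>z. vars (x z))"
  unfolding vars_def by (intro poly_time_intros poly_time_list_occurrences poly_time_list_atom_args)

lemma poly_time_list_elements:
  "poly_time x \<Longrightarrow> poly_time v \<Longrightarrow> poly_time_list (\<lambda>z. elements (x z) (v z))"
  unfolding elements_def by (intro poly_time_intros poly_time_lookup)

lemma poly_time_list_bindings:
  assumes "poly_time x"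
  shows "poly_time_list (\<lambda>z. bindings (x z))"
  unfolding bindings_def
  by (intro poly_time_intros poly_time_list_vars poly_time_list_elements assms
      poly_time_comp[OF assms])

lemma poly_time_list_tuples:
  "poly_time x \<Longrightarrow> poly_time R \<Longrightarrow> poly_time_list (\<lambda>z. tuples (x z) (R z))"
  unfolding tuples_def by (intro poly_time_intros poly_time_lookup)

lemma poly_time_list_short_lists:
  assumes "poly_time_list L"
  shows "poly_time_list (\<lambda>z. short_lists k (L z))"
proof (induction k)
  case (Suc k)
  then show ?case
    unfolding short_lists.simps by (intro poly_time_intros poly_time_list_comp[OF Suc.IH] assms)
qed (simp add: poly_time_list_Cons poly_time_list_Nil poly_time_const)

lemma poly_time_fact_tree:
  "poly_time tag \<Longrightarrow> poly_time p \<Longrightarrow> poly_time_list L \<Longrightarrow> poly_time (\<lambda>z. fact_tree (tag z) (p z) (L z))"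
  unfolding fact_tree_def by (intro poly_time_intros)

lemma poly_time_list_fact_members: "poly_time w \<Longrightarrow> poly_time_list (\<lambda>z. fact_members (w z))"
  unfolding fact_members_def by (intro poly_time_intros)

lemma poly_time_pred_inj_on_left:
  assumes "poly_time_list L"
  shows "poly_time_pred (\<lambda>z. inj_on left (set (L z)))"
  unfolding inj_on_def by (intro poly_time_intros assms poly_time_list_comp[OF assms])

lemma poly_time_list_candidates: "poly_time_list (candidates k)"
  unfolding candidates_def
  by (intro poly_time_intros poly_time_list_occurrences poly_time_list_vars poly_time_list_bindings
      poly_time_list_short_lists poly_time_fact_tree poly_time_pred_inj_on_left)

lemma poly_time_pred_known:
  assumes "poly_time_list S" and "poly_time tag" and "poly_time p" and "poly_time_list L"
  shows "poly_time_pred (\<lambda>z. known (S z) (tag z) (p z) (L z))"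
  unfolding known_def image_iff fact_content_def prod.inject
  by (intro poly_time_intros poly_time_list_fact_members assms assms(2,3)[THEN poly_time_comp]
      assms(4)[THEN poly_time_list_comp])

lemmas poly_time_rule_intros = poly_time_intros poly_time_lookup poly_time_pred_is_atom
  poly_time_pred_is_forall poly_time_atom_symbol poly_time_list_atom_args
  poly_time_list_quantified_vars poly_time_formula_at poly_time_list_child_paths poly_time_list_adjacent_paths poly_time_list_vars
  poly_time_list_elements poly_time_list_tuples poly_time_pred_known

lemma poly_time_pred_free_rule:
  assumes "poly_time x" and "poly_time_list S" and "poly_time p" and "poly_time v"
  shows "poly_time_pred (\<lambda>z. free_rule (x z) (S z) (p z) (v z))"
  unfolding free_rule_def
  by (intro poly_time_rule_intros assms assms(1,3,4)[THEN poly_time_comp]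
      assms(2)[THEN poly_time_list_comp])

lemma poly_time_pred_available_rule:
  assumes "poly_time x" and "poly_time_list S" and "poly_time p" and "poly_time_list L"
  shows "poly_time_pred (\<lambda>z. available_rule (x z) (S z) (p z) (L z))"
  unfolding available_rule_def
  by (intro poly_time_rule_intros assms assms(1,3)[THEN poly_time_comp]
      assms(2,4)[THEN poly_time_list_comp])

lemma poly_time_pred_excluded_rule:
  assumes "poly_time x" and "poly_time_list S" and "poly_time p" and "poly_time_list L"
  shows "poly_time_pred (\<lambda>z. excluded_rule (x z) (S z) (p z) (L z))"
  unfolding excluded_rule_def violates_atom_def excluded_projection_rule_def excluded_join_rule_def
    excluded_forall_rule_def
  by (intro poly_time_rule_intros assms assms(1,3)[THEN poly_time_comp]
      assms(2,4)[THEN poly_time_list_comp])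

lemma poly_time_list_saturate: "poly_time_list (saturate k)"
proof -
  have "poly_time_pred (\<lambda>z. fact_rule (left (left z)) (list_of_tree (right (left z))) (right z))"
    unfolding fact_rule_def
    by (intro poly_time_intros poly_time_pred_free_rule poly_time_pred_available_rule
        poly_time_pred_excluded_rule poly_time_list_fact_members)
  from poly_time_list_saturation[OF poly_time_list_candidates this] show ?thesis
    by (simp add: saturate_def[abs_def])
qed

section \<open>Encoded formulas and maps\<close>

lemma enc_list_eq: "enc_list e xs = tree_of_list (map e xs)"
  unfolding enc_list_def by (induction xs) auto

lemma enc_pair_simps [simp]:
  "left (enc_pair e d p) = e (fst p)" "right (enc_pair e d p) = d (snd p)"
  by (simp_all add: enc_pair_def)

lemma inj_enc_list: "inj e \<Longrightarrow> inj (enc_list e)"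
  by (rule injI) (simp add: enc_list_eq inj_map_eq_map)

lemma inj_enc_pair: "inj e \<Longrightarrow> inj d \<Longrightarrow> inj (enc_pair e d)"
  by (rule injI) (auto simp: enc_pair_def prod_eq_iff dest: injD)

lemma enc_bool_eq_iff [simp]: "enc_bool a = enc_bool b \<longleftrightarrow> a = b"
  by (cases a; cases b) auto

lemma inj_enc_name: "inj enc_name"
  unfolding enc_name_def by (rule inj_enc_list) (simp add: inj_def)

lemma inj_enc_var: "inj enc_var"
  unfolding enc_var_def by (intro inj_enc_pair inj_enc_name)

lemmas enc_var_eq_iff [simp] = inj_eq[OF inj_enc_var]
lemmas enc_var_image_eq_iff [simp] = inj_image_eq_iff[OF inj_enc_var]
lemmas enc_var_image_mem_iff [simp] = inj_image_mem_iff[OF inj_enc_var]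

lemma card_enc_var_image [simp]: "card (enc_var ` V) = card V"
  by (rule card_image[OF inj_on_subset[OF inj_enc_var]]) simp

lemma enc_tag_eq_iff [simp]: "enc_tag a b = enc_tag c d \<longleftrightarrow> a = c \<and> b = d"
  by (simp add: enc_tag_def)

lemma is_atom_enc_qc: "is_atom (enc_qc \<psi>) \<longleftrightarrow> (\<exists>R vs. \<psi> = Atom R vs)"
  by (cases \<psi>) (auto simp: is_atom_def)

lemma is_forall_enc_qc: "is_forall (enc_qc \<psi>) \<longleftrightarrow> (\<exists>y \<chi>. \<psi> = Forall y \<chi>)"
  by (cases \<psi>) (auto simp: is_forall_def)

lemma atom_symbol_enc_qc: "atom_symbol (enc_qc (Atom R vs)) = enc_name R"
  by (simp add: atom_symbol_def)

lemma atom_args_enc_qc: "atom_args (enc_qc (Atom R vs)) = map enc_var vs"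
  by (simp add: atom_args_def is_atom_def enc_list_eq)

lemma set_atom_args_enc_qc:
  "set (atom_args (enc_qc \<psi>)) = enc_var ` {v. \<exists>R vs. \<psi> = Atom R vs \<and> v \<in> set vs}"
  by (cases \<psi>) (auto simp: atom_args_def is_atom_def enc_list_eq)

lemma set_quantified_vars_enc_qc [simp]: "set (quantified_vars (enc_qc \<psi>)) = enc_var ` bound_vars \<psi>"
  by (cases \<psi>) (auto simp: quantified_vars_def is_forall_def)

lemma child_codes_enc_qc: "child_codes (enc_qc \<psi>) = map enc_qc (children \<psi>)"
  by (cases \<psi>) (auto simp: child_codes_def quantified_vars_def is_forall_def enc_list_eq)

definition path_tree :: "index \<Rightarrow> tree" where
  "path_tree i = tree_of_list (map unary (rev i))"

lemma path_tree_simps [simp]: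
  "path_tree [] = Leaf" "path_tree (i @ [n]) = Node (unary n) (path_tree i)"
  by (simp_all add: path_tree_def)

lemma inj_path_tree: "inj path_tree"
proof (rule injI)
  have "inj unary" by (rule injI) simp
  then show "i = j" if "path_tree i = path_tree j" for i j
    using that unfolding path_tree_def by (simp add: inj_map_eq_map)
qed

lemmas path_tree_eq_iff [simp] = inj_eq[OF inj_path_tree]

lemma set_level_enc_qc:
  "set (level (enc_qc \<phi>) n) =
     (\<lambda>i. Node (path_tree i) (enc_qc (subf \<phi> i))) ` {i \<in> indices \<phi>. length i = n}"
proof (induction n)
  case (Suc n)
  have "level (enc_qc \<phi>) (Suc n) = next_level (level (enc_qc \<phi>) n)" by (simp add: level_def)
  then have "set (level (enc_qc \<phi>) (Suc n)) =
      (\<Union>i\<in>{i \<in> indices \<phi>. length i = n}. \<Union>m\<in>{..<length (children (subf \<phi> i))}.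
        {Node (path_tree (i @ [m])) (enc_qc (children (subf \<phi> i) ! m))})"
    by (auto simp: next_level_def Suc set_numbered child_codes_enc_qc image_iff)
  also have "\<dots> = (\<Union>i\<in>{i \<in> indices \<phi>. length i = n}. \<Union>m\<in>{m. i @ [m] \<in> indices \<phi>}.
        {Node (path_tree (i @ [m])) (enc_qc (subf \<phi> (i @ [m])))})"
    by (intro SUP_cong) (auto simp: snoc_in_indices_iff subf_snoc)
  also have "\<dots> = (\<lambda>i. Node (path_tree i) (enc_qc (subf \<phi> i))) ` {i \<in> indices \<phi>. length i = Suc n}"
  proof -
    have "{j \<in> indices \<phi>. length j = Suc n} =
        (\<Union>i\<in>{i \<in> indices \<phi>. length i = n}. \<Union>m\<in>{m. i @ [m] \<in> indices \<phi>}. {i @ [m]})"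
      by (auto simp: length_Suc_conv_rev snoc_in_indices_iff)
    then show ?thesis by (simp only: image_UN image_insert image_empty)
  qed
  finally show ?case .
qed (auto simp: level_def)

lemma set_occurrences_enc_qc:
  "set (occurrences (enc_qc \<phi>)) = (\<lambda>i. Node (path_tree i) (enc_qc (subf \<phi> i))) ` indices \<phi>"
proof -
  have "length i < depth (enc_qc \<phi>)" if "i \<in> indices \<phi>" for i
  proof (rule ccontr)
    assume "\<not> length i < depth (enc_qc \<phi>)"
    then obtain m where "length i = m + depth (enc_qc \<phi>)"
      using le_Suc_ex by (metis add.commute not_less)
    moreover have "(next_level ^^ m) [] = []" by (induction m) (simp_all add: next_level_def)
    ultimately have "level (enc_qc \<phi>) (length i) = []"
      using level_depth by (simp add: level_def funpow_add)
    then show False using set_level_enc_qc[of \<phi> "length i"] that by auto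
  qed
  then show ?thesis
    unfolding occurrences_def by (fastforce simp: set_level_enc_qc)
qed

lemma set_short_lists:
  "set (short_lists k L) = {l. set (list_of_tree l) \<subseteq> set L \<and> length (list_of_tree l) \<le> k}"
proof -
  have "l \<in> set (short_lists k L) \<longleftrightarrow>
      set (list_of_tree l) \<subseteq> set L \<and> length (list_of_tree l) \<le> k" for l
  proof (induction k arbitrary: l)
    case 0
    then show ?case by (cases l) auto
  next
    case (Suc k)
    then show ?case by (cases l) auto
  qed
  then show ?thesis by blast
qed

lemma short_lists_complete:
  assumes "finite X" and "X \<subseteq> set L" and "card X \<le> k"
  shows "\<exists>l\<in>set (short_lists k L). set (list_of_tree l) = X"
proof -
  obtain ys where "set ys = X" "distinct ys"
    using finite_distinct_list[OF assms(1)] by blast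
  then show ?thesis
    using assms(2,3)
    by (intro bexI[of _ "tree_of_list ys"]) (auto simp: set_short_lists distinct_card)
qed

lemma lookup_enc_pair:
  assumes "inj e" and "distinct (map fst kvs)" and "(key, v) \<in> set kvs"
  shows "lookup (map (enc_pair e d) kvs) (e key) = d v"
proof -
  let ?p = "enc_pair e d (key, v)"
  have "lookup (map (enc_pair e d) kvs) (left ?p) = right ?p"
  proof (rule lookup_eqI)
    show "?p \<in> set (map (enc_pair e d) kvs)" using assms(3) by simp
    fix t assume "t \<in> set (map (enc_pair e d) kvs)" "left t = left ?p"
    then obtain c w where t: "(c, w) \<in> set kvs" "t = enc_pair e d (c, w)" "e c = e key"
      by auto
    moreover from this have "c = key" using injD[OF assms(1)] by blast
    ultimately show "right t = right ?p"
      using eq_key_imp_eq_value[OF assms(2,3)] by simp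
  qed
  then show ?thesis by simp
qed

lemma graph_subset_iff_maps:
  "Map.graph f \<subseteq> {(v, b). v \<in> A \<and> b \<in> univ B (sort_of v)} \<longleftrightarrow> dom f \<subseteq> A \<and> f \<in> maps B (dom f)"
  unfolding graph_eq_to_snd_dom by (auto simp: maps_def)

definition graph_code :: "((name, name) var \<rightharpoonup> name) \<Rightarrow> tree set" where
  "graph_code f = enc_pair enc_var enc_name ` Map.graph f"

lemma enc_pair_var_name_eq_iff [simp]:
  "enc_pair enc_var enc_name p = enc_pair enc_var enc_name q \<longleftrightarrow> p = q"
  using inj_eq[OF inj_enc_pair[OF inj_enc_var inj_enc_name]] .

lemma Node_in_graph_code_iff [simp]:
  "Node (enc_var v) (enc_name b) \<in> graph_code f \<longleftrightarrow> f v = Some b"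
proof -
  have "Node (enc_var v) (enc_name b) = enc_pair enc_var enc_name (v, b)"
    by (simp add: enc_pair_def)
  then show ?thesis
    unfolding graph_code_def
    by (metis in_graphD in_graphI inj_enc_name inj_enc_pair inj_enc_var inj_image_mem_iff)
qed

lemma graph_code_eq_iff [simp]: "graph_code f = graph_code g \<longleftrightarrow> f = g"
proof
  assume "graph_code f = graph_code g"
  then have "f v = Some b \<longleftrightarrow> g v = Some b" for v b
    using Node_in_graph_code_iff by metis
  then show "f = g" by (intro ext) (metis option.exhaust)
qed simp

lemma graph_code_empty [simp]: "graph_code Map.empty = {}"
  by (simp add: graph_code_def)

lemma left_graph_code [simp]: "left ` graph_code f = enc_var ` dom f"
  by (simp add: graph_code_def image_image flip: fst_graph_eq_dom)

lemma graph_code_upd: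
  "graph_code (f(y \<mapsto> b)) = insert (Node (enc_var y) (enc_name b)) (graph_code (f(y := None)))"
  by (simp add: graph_code_def enc_pair_def)

lemma graph_code_remove:
  assumes "f y = Some b"
  shows "graph_code (f(y := None)) = graph_code f - {Node (enc_var y) (enc_name b)}"
proof -
  have "f(y \<mapsto> b) = f" using assms by auto
  then have "graph_code f = insert (Node (enc_var y) (enc_name b)) (graph_code (f(y := None)))"
    using graph_code_upd[of f y b] by simp
  moreover have "Node (enc_var y) (enc_name b) \<notin> graph_code (f(y := None))" by simp
  ultimately show ?thesis by blast
qed

lemma inj_on_left_graph_code: "inj_on left (graph_code f)"
  by (auto simp: graph_code_def Map.graph_def enc_pair_def inj_on_def)

lemma finite_graph_code: "finite (dom f) \<Longrightarrow> finite (graph_code f)"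
  by (simp add: graph_code_def)

lemma card_graph_code: "card (graph_code f) = card (dom f)"
  using card_image[OF inj_on_left_graph_code[of f]] by simp

lemma inj_on_left_graph_codeE:
  assumes "inj_on left X" and "finite X" and "X \<subseteq> range (enc_pair enc_var enc_name)"
  obtains f where "X = graph_code f"
proof -
  obtain ps where X: "X = enc_pair enc_var enc_name ` set ps" and ps: "distinct ps"
    using assms(2,3) by (metis finite_distinct_list finite_subset_image)
  have "inj_on fst (set ps)"
    using assms(1) unfolding X by (auto simp: inj_on_def)
  then have "Map.graph (map_of ps) = set ps"
    using ps by (simp add: graph_map_of_if_distinct_dom distinct_map)
  then show thesis using that[of "map_of ps"] X by (simp add: graph_code_def)
qed

lemma lookup_graph_code:
  assumes "set l = graph_code f" and "v \<in> dom f"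
  shows "lookup l (enc_var v) = enc_name (the (f v))"
proof -
  obtain b where b: "f v = Some b" using assms(2) by blast
  let ?a = "Node (enc_var v) (enc_name b)"
  have "lookup l (left ?a) = right ?a"
  proof (rule lookup_eqI)
    show "?a \<in> set l" using assms(1) b by simp
    show "right d = right ?a" if "d \<in> set l" "left d = left ?a" for d
      using inj_onD[OF inj_on_left_graph_code[of f] that(2)] that(1) assms(1) b by simp
  qed
  then show ?thesis using b by simp
qed

section \<open>Correctness of the algorithm\<close>

definition free_fact :: "index \<Rightarrow> (name, name) var \<Rightarrow> content" where
  "free_fact i v = (free_tag, path_tree i, {enc_var v})"

definition available_fact :: "index \<Rightarrow> (name, name) var set \<Rightarrow> content" where
  "available_fact i V = (available_tag, path_tree i, enc_var ` V)"

definition excluded_fact :: "index \<Rightarrow> ((name, name) var \<rightharpoonup> name) \<Rightarrow> content" where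
  "excluded_fact i f = (excluded_tag, path_tree i, graph_code f)"

lemmas fact_defs = free_fact_def available_fact_def excluded_fact_def

lemma fact_content_tree: "fact_content (fact_tree tag p l) = (tag, p, set l)"
  by (simp add: fact_content_def fact_tree_def fact_members_def)

lemma fact_rule_fact_tree:
  "fact_rule x S (fact_tree free_tag p [v]) \<longleftrightarrow> free_rule x S p v"
  "fact_rule x S (fact_tree available_tag p l) \<longleftrightarrow> available_rule x S p l"
  "fact_rule x S (fact_tree excluded_tag p l) \<longleftrightarrow> excluded_rule x S p l"
  by (simp_all add: fact_rule_def fact_tree_def fact_members_def)

lemma known_free_iff:
  "known S free_tag (path_tree i) [enc_var v] \<longleftrightarrow> free_fact i v \<in> fact_content ` set S"
  by (simp add: known_def free_fact_def)

lemma known_available_iff: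
  "set l = enc_var ` V \<Longrightarrow>
   known S available_tag (path_tree i) l \<longleftrightarrow> available_fact i V \<in> fact_content ` set S"
  by (simp add: known_def available_fact_def)

lemma known_excluded_iff:
  "set l = graph_code f \<Longrightarrow>
   known S excluded_tag (path_tree i) l \<longleftrightarrow> excluded_fact i f \<in> fact_content ` set S"
  by (simp add: known_def excluded_fact_def)

locale encoded_instance =
  fixes \<phi> :: "(name, name, name) qc" and B :: "(name, name, name) struct"
    and us :: sort_table and rs :: symbol_table and x :: tree
  assumes inst: "qcsp_instance \<phi> B" and finite: "finite_struct B"
    and tables: "lists_struct us rs B"
    and x_def: "x = Node (enc_qc \<phi>)
           (Node (enc_list (enc_pair enc_name (enc_list enc_name)) us)
                 (enc_list (enc_pair enc_name
                     (enc_pair (enc_list enc_name) (enc_list (enc_list enc_name)))) rs))"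
begin

lemma set_occurrences:
  "set (occurrences (left x)) = (\<lambda>i. Node (path_tree i) (enc_qc (subf \<phi> i))) ` indices \<phi>"
  by (simp add: x_def set_occurrences_enc_qc)

lemma formula_at_path_tree:
  assumes "i \<in> indices \<phi>"
  shows "formula_at x (path_tree i) = enc_qc (subf \<phi> i)"
proof -
  let ?e = "Node (path_tree i) (enc_qc (subf \<phi> i))"
  have "lookup (occurrences (left x)) (left ?e) = right ?e"
    by (rule lookup_eqI) (use assms in \<open>auto simp: set_occurrences\<close>)
  then show ?thesis by (simp add: formula_at_def)
qed

lemma set_child_paths: "set (child_paths x (path_tree i)) = path_tree ` {j. parent \<phi> i j}"
proof -
  have "path_tree j \<noteq> Leaf \<and> right (path_tree j) = path_tree i \<longleftrightarrow> (\<exists>n. j = i @ [n])" for j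
    by (cases j rule: rev_cases) auto
  moreover have "set (child_paths x (path_tree i)) =
      path_tree ` {j \<in> indices \<phi>. path_tree j \<noteq> Leaf \<and> right (path_tree j) = path_tree i}"
    by (auto simp: child_paths_def set_occurrences image_image)
  ultimately show ?thesis by (simp only: parent_iff_snoc)
qed

lemma set_adjacent_paths:
  assumes "i \<in> indices \<phi>"
  shows "set (adjacent_paths x (path_tree i)) = path_tree ` {j. adjacent \<phi> i j}"
proof -
  have "set (if path_tree i = Leaf then [] else [right (path_tree i)]) =
      path_tree ` {j. parent \<phi> j i}"
    using assms by (cases i rule: rev_cases) (auto simp: parent_iff_snoc)
  then show ?thesis
    unfolding adjacent_paths_def by (auto simp: set_child_paths)
qed

lemma set_vars: "set (vars x) = enc_var ` atom_vars \<phi>"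
proof -
  have "set (vars x) = (\<Union>i\<in>indices \<phi>. set (atom_args (enc_qc (subf \<phi> i))))"
    by (simp add: vars_def set_occurrences)
  then show ?thesis unfolding set_atom_args_enc_qc atom_vars_def by blast
qed

lemma set_elements:
  assumes "sort_of v \<in> sorts B"
  shows "set (elements x (enc_var v)) = enc_name ` univ B (sort_of v)"
proof -
  have us: "distinct (map fst us)" "set (map fst us) = sorts B"
    and univ: "\<And>s bs. (s, bs) \<in> set us \<Longrightarrow> set bs = univ B s"
    using tables unfolding lists_struct_def by fast+
  obtain bs where bs: "(sort_of v, bs) \<in> set us" using assms us(2) by fastforce
  have "elements x (enc_var v) = map enc_name bs"
    using lookup_enc_pair[OF inj_enc_name us(1) bs]
    by (simp add: elements_def x_def enc_list_eq enc_var_def)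
  then show ?thesis using univ[OF bs] by simp
qed

lemma set_bindings:
  "set (bindings x) =
     enc_pair enc_var enc_name ` {(v, b). v \<in> atom_vars \<phi> \<and> b \<in> univ B (sort_of v)}"
proof -
  have "set (bindings x) = (\<Union>v\<in>atom_vars \<phi>. Node (enc_var v) ` set (elements x (enc_var v)))"
    by (auto simp: bindings_def set_vars)
  also have "\<dots> = (\<Union>v\<in>atom_vars \<phi>. Node (enc_var v) ` enc_name ` univ B (sort_of v))"
    using set_elements sort_of_atom_vars[OF inst] by simp
  finally show ?thesis by (force simp: enc_pair_def)
qed

lemma tuples_iff:
  assumes "R \<in> symbols B"
  shows "tree_of_list (map enc_name bs) \<in> set (tuples x (enc_name R)) \<longleftrightarrow> bs \<in> rel B R"
proof -
  have rs: "distinct (map fst rs)" "set (map fst rs) = symbols B"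
    and rel: "\<And>R ss ts. (R, ss, ts) \<in> set rs \<Longrightarrow> set ts = rel B R"
    using tables unfolding lists_struct_def by fast+
  obtain ss ts where ts: "(R, ss, ts) \<in> set rs" using assms rs(2) by fastforce
  have "tuples x (enc_name R) = map (enc_list enc_name) ts"
    using lookup_enc_pair[OF inj_enc_name rs(1) ts] by (simp add: tuples_def x_def enc_list_eq)
  then show ?thesis
    using rel[OF ts] inj_image_mem_iff[OF inj_enc_list[OF inj_enc_name], of bs "set ts"]
    by (simp add: enc_list_eq[symmetric])
qed

definition true_facts :: "nat \<Rightarrow> content set" where
  "true_facts k = {free_fact i v | i v. free_at \<phi> i v} \<union>
     {available_fact i V | i V. available k \<phi> i V} \<union>
     {excluded_fact i f | i f. excluded k \<phi> B i f}"

lemma true_facts_iff [simp]: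
  "free_fact i v \<in> true_facts k \<longleftrightarrow> free_at \<phi> i v"
  "available_fact i V \<in> true_facts k \<longleftrightarrow> available k \<phi> i V"
  "excluded_fact i f \<in> true_facts k \<longleftrightarrow> excluded k \<phi> B i f"
  by (auto simp: true_facts_def fact_defs simp del: split_paired_Ex)

definition free_step :: "content set \<Rightarrow> index \<Rightarrow> (name, name) var \<Rightarrow> bool" where
  "free_step X i v \<longleftrightarrow> (\<exists>R vs. subf \<phi> i = Atom R vs \<and> v \<in> set vs) \<or>
     v \<notin> bound_vars (subf \<phi> i) \<and> (\<exists>j. parent \<phi> i j \<and> free_fact j v \<in> X)"

definition available_step ::
  "content set \<Rightarrow> index \<Rightarrow> (name, name) var set \<Rightarrow> bool" where
  "available_step X i V \<longleftrightarrow> (\<exists>R vs. subf \<phi> i = Atom R vs \<and> V = set vs) \<or>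
     (\<exists>y\<in>atom_vars \<phi>. available_fact i (insert y V) \<in> X) \<or>
     (\<exists>y\<in>V. available_fact i (V - {y}) \<in> X \<and> available_fact i {y} \<in> X) \<or>
     (\<forall>v\<in>V. free_fact i v \<in> X) \<and> (\<exists>j. adjacent \<phi> i j \<and> available_fact j V \<in> X)"

definition excluded_step ::
  "content set \<Rightarrow> index \<Rightarrow> ((name, name) var \<rightharpoonup> name) \<Rightarrow> bool" where
  "excluded_step X i f \<longleftrightarrow>
     (\<exists>R vs. subf \<phi> i = Atom R vs \<and> dom f = set vs \<and> map (\<lambda>v. the (f v)) vs \<notin> rel B R) \<or>
     (\<exists>y\<in>atom_vars \<phi>. y \<notin> dom f \<and> available_fact i (insert y (dom f)) \<in> X \<and>
       (\<forall>b\<in>univ B (sort_of y). excluded_fact i (f(y \<mapsto> b)) \<in> X)) \<or>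
     available_fact i (dom f) \<in> X \<and> (\<exists>y\<in>dom f. excluded_fact i (f(y := None)) \<in> X) \<or>
     (\<forall>v\<in>dom f. free_fact i v \<in> X) \<and> (\<exists>j. adjacent \<phi> i j \<and> excluded_fact j f \<in> X) \<or>
     (\<exists>y j. subf \<phi> i = Forall y (subf \<phi> j) \<and> y \<notin> dom f \<and> parent \<phi> i j \<and>
       (\<exists>b\<in>univ B (sort_of y). excluded_fact j (f(y \<mapsto> b)) \<in> X))"

lemma free_rule_iff:
  assumes "i \<in> indices \<phi>"
  shows "free_rule x S (path_tree i) (enc_var v) \<longleftrightarrow> free_step (fact_content ` set S) i v"
  unfolding free_rule_def free_step_def formula_at_path_tree[OF assms] set_atom_args_enc_qc
    set_child_paths
  by (simp add: known_free_iff)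

lemma available_rule_iff:
  assumes i: "i \<in> indices \<phi>" and l: "set l = enc_var ` V"
  shows "available_rule x S (path_tree i) l \<longleftrightarrow> available_step (fact_content ` set S) i V"
proof -
  have atom: "is_atom (enc_qc (subf \<phi> i)) \<and> set l = set (atom_args (enc_qc (subf \<phi> i))) \<longleftrightarrow>
      (\<exists>R vs. subf \<phi> i = Atom R vs \<and> V = set vs)"
    by (auto simp: is_atom_enc_qc atom_args_enc_qc l simp del: enc_qc.simps)
  have projection: "known S available_tag (path_tree i) (enc_var y # l) \<longleftrightarrow>
      available_fact i (insert y V) \<in> fact_content ` set S" for y
    by (rule known_available_iff) (simp add: l)
  have join: "known S available_tag (path_tree i) (filter (\<lambda>v. v \<noteq> enc_var y) l) \<longleftrightarrow>
      available_fact i (V - {y}) \<in> fact_content ` set S" for y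
    by (rule known_available_iff) (auto simp: l)
  have singleton: "known S available_tag (path_tree i) [enc_var y] \<longleftrightarrow>
      available_fact i {y} \<in> fact_content ` set S" for y
    by (rule known_available_iff) simp
  show ?thesis
    unfolding available_rule_def available_step_def formula_at_path_tree[OF i] atom set_vars
      set_adjacent_paths[OF i]
    by (simp add: projection join singleton known_free_iff known_available_iff[OF l] l)
qed

lemma violates_atom_iff:
  assumes i: "i \<in> indices \<phi>" and l: "set l = graph_code f"
  shows "violates_atom x (enc_qc (subf \<phi> i)) l \<longleftrightarrow>
    (\<exists>R vs. subf \<phi> i = Atom R vs \<and> dom f = set vs \<and> map (\<lambda>v. the (f v)) vs \<notin> rel B R)"
proof (cases "\<exists>R vs. subf \<phi> i = Atom R vs \<and> dom f = set vs")
  case True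
  then obtain R vs where atom: "subf \<phi> i = Atom R vs" and dom: "dom f = set vs" by blast
  have "map (\<lambda>v. lookup l v) (map enc_var vs) = map enc_name (map (\<lambda>v. the (f v)) vs)"
    using lookup_graph_code[OF l] dom by simp
  moreover have "R \<in> symbols B"
    using inst well_sorted_subf[of B \<phi> i] i atom by (simp add: qcsp_instance_def)
  ultimately have "violates_atom x (enc_qc (subf \<phi> i)) l \<longleftrightarrow> map (\<lambda>v. the (f v)) vs \<notin> rel B R"
    unfolding violates_atom_def atom atom_args_enc_qc atom_symbol_enc_qc is_atom_enc_qc
    by (simp only: tuples_iff) (simp add: l dom)
  then show ?thesis using atom dom by simp
next
  case False
  then show ?thesis
    by (auto simp: violates_atom_def is_atom_enc_qc atom_args_enc_qc l simp del: enc_qc.simps)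
qed

lemma known_excluded_upd_iff:
  assumes "set l = graph_code f" and "y \<notin> dom f"
  shows "known S excluded_tag (path_tree j) (Node (enc_var y) (enc_name b) # l) \<longleftrightarrow>
    excluded_fact j (f(y \<mapsto> b)) \<in> fact_content ` set S"
proof (rule known_excluded_iff)
  have "f(y := None) = f" using assms(2) by auto
  then show "set (Node (enc_var y) (enc_name b) # l) = graph_code (f(y \<mapsto> b))"
    by (simp add: assms(1) graph_code_upd)
qed

lemma excluded_projection_rule_iff:
  assumes l: "set l = graph_code f"
  shows "excluded_projection_rule x S (path_tree i) l \<longleftrightarrow>
    (\<exists>y\<in>atom_vars \<phi>. y \<notin> dom f \<and> available_fact i (insert y (dom f)) \<in> fact_content ` set S \<and>
      (\<forall>b\<in>univ B (sort_of y). excluded_fact i (f(y \<mapsto> b)) \<in> fact_content ` set S))"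
proof -
  have "enc_var y \<notin> set (map left l) \<and>
      known S available_tag (path_tree i) (enc_var y # map left l) \<and>
      (\<forall>b\<in>set (elements x (enc_var y)).
        known S excluded_tag (path_tree i) (Node (enc_var y) b # l)) \<longleftrightarrow>
    y \<notin> dom f \<and> available_fact i (insert y (dom f)) \<in> fact_content ` set S \<and>
      (\<forall>b\<in>univ B (sort_of y). excluded_fact i (f(y \<mapsto> b)) \<in> fact_content ` set S)"
    if "y \<in> atom_vars \<phi>" for y
  proof (cases "y \<in> dom f")
    case False
    have "known S available_tag (path_tree i) (enc_var y # map left l) \<longleftrightarrow>
        available_fact i (insert y (dom f)) \<in> fact_content ` set S"
      by (rule known_available_iff) (simp add: l)
    then show ?thesis
      using False set_elements[OF sort_of_atom_vars[OF inst that]]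
      by (simp add: l known_excluded_upd_iff[OF l] del: fun_upd_apply)
  qed (simp add: l)
  then show ?thesis
    unfolding excluded_projection_rule_def set_vars by simp
qed

lemma excluded_join_rule_iff:
  assumes l: "set l = graph_code f"
  shows "excluded_join_rule S (path_tree i) l \<longleftrightarrow> available_fact i (dom f) \<in> fact_content ` set S \<and>
    (\<exists>y\<in>dom f. excluded_fact i (f(y := None)) \<in> fact_content ` set S)"
proof -
  have "known S available_tag (path_tree i) (map left l) \<longleftrightarrow>
      available_fact i (dom f) \<in> fact_content ` set S"
    by (rule known_available_iff) (simp add: l)
  moreover have "known S excluded_tag (path_tree i)
        (filter (\<lambda>c. c \<noteq> Node (enc_var y) (enc_name b)) l) \<longleftrightarrow>
      excluded_fact i (f(y := None)) \<in> fact_content ` set S" if "f y = Some b" for y b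
    using that by (intro known_excluded_iff) (auto simp: l graph_code_remove)
  ultimately show ?thesis
    unfolding excluded_join_rule_def l graph_code_def Map.graph_def enc_pair_def by fastforce
qed

lemma excluded_forall_rule_iff:
  assumes i: "i \<in> indices \<phi>" and l: "set l = graph_code f"
  shows "excluded_forall_rule x S (path_tree i) l \<longleftrightarrow>
    (\<exists>y j. subf \<phi> i = Forall y (subf \<phi> j) \<and> y \<notin> dom f \<and> parent \<phi> i j \<and>
      (\<exists>b\<in>univ B (sort_of y). excluded_fact j (f(y \<mapsto> b)) \<in> fact_content ` set S))"
proof (cases "\<exists>y \<chi>. subf \<phi> i = Forall y \<chi>")
  case True
  then obtain y \<chi> where y: "subf \<phi> i = Forall y \<chi>" by blast
  then have sort: "sort_of y \<in> sorts B"
    using inst well_sorted_subf[of B \<phi> i] i by (simp add: qcsp_instance_def)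
  have child: "subf \<phi> j = \<chi>" if "parent \<phi> i j" for j
    using set_children_subf[OF i] that y by auto
  have "is_forall (enc_qc (subf \<phi> i))" "set (quantified_vars (enc_qc (subf \<phi> i))) = {enc_var y}"
    unfolding is_forall_enc_qc set_quantified_vars_enc_qc y by simp_all
  then have "excluded_forall_rule x S (path_tree i) l \<longleftrightarrow> y \<notin> dom f \<and> (\<exists>j. parent \<phi> i j \<and>
      (\<exists>b\<in>univ B (sort_of y).
        known S excluded_tag (path_tree j) (Node (enc_var y) (enc_name b) # l)))"
    by (simp add: excluded_forall_rule_def formula_at_path_tree[OF i] set_child_paths
        set_elements[OF sort] l)
  also have "\<dots> \<longleftrightarrow> y \<notin> dom f \<and> (\<exists>j. parent \<phi> i j \<and>
      (\<exists>b\<in>univ B (sort_of y). excluded_fact j (f(y \<mapsto> b)) \<in> fact_content ` set S))"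
    using known_excluded_upd_iff[OF l] by (cases "y \<in> dom f") (simp_all del: fun_upd_apply)
  finally show ?thesis using y child by (metis qc.inject(3))
next
  case False
  then show ?thesis
    by (auto simp: excluded_forall_rule_def formula_at_path_tree[OF i] is_forall_enc_qc)
qed

lemma excluded_rule_iff:
  assumes i: "i \<in> indices \<phi>" and l: "set l = graph_code f"
  shows "excluded_rule x S (path_tree i) l \<longleftrightarrow> excluded_step (fact_content ` set S) i f"
proof -
  have free: "(\<forall>v\<in>set (map left l). known S free_tag (path_tree i) [v]) \<longleftrightarrow>
      (\<forall>v\<in>dom f. free_fact i v \<in> fact_content ` set S)"
    by (simp add: l known_free_iff)
  have flow: "(\<exists>q\<in>set (adjacent_paths x (path_tree i)). known S excluded_tag q l) \<longleftrightarrow>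
      (\<exists>j. adjacent \<phi> i j \<and> excluded_fact j f \<in> fact_content ` set S)"
    by (simp add: set_adjacent_paths[OF i] known_excluded_iff[OF l])
  show ?thesis
    unfolding excluded_rule_def excluded_step_def formula_at_path_tree[OF i]
      violates_atom_iff[OF i l] excluded_projection_rule_iff[OF l] excluded_join_rule_iff[OF l]
      free flow excluded_forall_rule_iff[OF i l] by simp
qed

lemma free_step_sound:
  assumes "X \<subseteq> true_facts k" and "i \<in> indices \<phi>" and "free_step X i v"
  shows "free_at \<phi> i v"
  using assms free_at_atom free_at_parent unfolding free_step_def
  by (metis subsetD true_facts_iff(1))

lemma available_step_sound:
  assumes X: "X \<subseteq> true_facts k" and i: "i \<in> indices \<phi>" and "card V \<le> k" and "available_step X i V"
  shows "available k \<phi> i V"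
proof -
  have free: "free_at \<phi> j v" if "free_fact j v \<in> X" for j v using X that by auto
  have available: "available k \<phi> j W" if "available_fact j W \<in> X" for j W using X that by auto
  consider (atom) R vs where "subf \<phi> i = Atom R vs" "V = set vs"
    | (projection) y where "available_fact i (insert y V) \<in> X"
    | (join) y where "y \<in> V" "available_fact i (V - {y}) \<in> X" "available_fact i {y} \<in> X"
    | (flow) j where "\<forall>v\<in>V. free_fact i v \<in> X" "adjacent \<phi> i j" "available_fact j V \<in> X"
    using assms(4) unfolding available_step_def by blast
  then show ?thesis
  proof cases
    case atom
    then show ?thesis using i assms(3) available_atom[of i \<phi> R vs k] by simp
  next
    case projection
    then show ?thesis using available available_projection by blast
  next
    case join
    then show ?thesis
      using available available_join[of k \<phi> i "V - {y}" y] assms(3) by (simp add: insert_absorb)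
  next
    case flow
    then have "V \<subseteq> free (subf \<phi> i)" using free free_at_iff by blast
    then show ?thesis using flow available available_flow by blast
  qed
qed

lemma excluded_step_sound:
  assumes X: "X \<subseteq> true_facts k" and i: "i \<in> indices \<phi>"
    and f: "f \<in> maps B (dom f)" "card (dom f) \<le> k" and "excluded_step X i f"
  shows "excluded k \<phi> B i f"
proof -
  have free: "free_at \<phi> j v" if "free_fact j v \<in> X" for j v using X that by auto
  have available: "available k \<phi> j V" if "available_fact j V \<in> X" for j V using X that by auto
  have excluded: "excluded k \<phi> B j g" if "excluded_fact j g \<in> X" for j g using X that by auto
  consider (atom) R vs where "subf \<phi> i = Atom R vs" "dom f = set vs"
        "map (\<lambda>v. the (f v)) vs \<notin> rel B R"
    | (projection) y where "y \<notin> dom f" "available_fact i (insert y (dom f)) \<in> X"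
        "\<forall>b\<in>univ B (sort_of y). excluded_fact i (f(y \<mapsto> b)) \<in> X"
    | (join) y where "available_fact i (dom f) \<in> X" "y \<in> dom f" "excluded_fact i (f(y := None)) \<in> X"
    | (flow) j where "\<forall>v\<in>dom f. free_fact i v \<in> X" "adjacent \<phi> i j" "excluded_fact j f \<in> X"
    | (forall_elim) y j b where "subf \<phi> i = Forall y (subf \<phi> j)" "y \<notin> dom f" "parent \<phi> i j"
        "excluded_fact j (f(y \<mapsto> b)) \<in> X"
    using assms(5) unfolding excluded_step_def by blast
  then show ?thesis
  proof cases
    case atom
    then show ?thesis using i f excluded_atom[of i \<phi> R vs k f B] by simp
  next
    case projection
    then show ?thesis using f(1) available excluded excluded_projection by blast
  next
    case join
    have "f |` (- {y}) = f(y := None)" by (rule restrict_complement_singleton_eq)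
    then show ?thesis
      using excluded_from_restriction[of k \<phi> B i f "- {y}"] excluded[OF join(3)]
        available[OF join(1)] f(1) by simp
  next
    case flow
    then have "dom f \<subseteq> free (subf \<phi> i)" using free free_at_iff by blast
    then show ?thesis using flow excluded excluded_flow by blast
  next
    case forall_elim
    then show ?thesis
      using excluded[OF forall_elim(4)] by (intro excluded_forall_elim[of k \<phi> B j f y b i])
  qed
qed

lemma set_candidates:
  "set (candidates k x) = (\<Union>i\<in>indices \<phi>.
     (\<lambda>v. fact_tree free_tag (path_tree i) [enc_var v]) ` atom_vars \<phi> \<union>
     (\<lambda>t. fact_tree available_tag (path_tree i) (list_of_tree t)) ` set (short_lists k (vars x)) \<union>
     (\<lambda>t. fact_tree excluded_tag (path_tree i) (list_of_tree t)) `
       {t \<in> set (short_lists k (bindings x)). inj_on left (set (list_of_tree t))})"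
  by (simp add: candidates_def set_occurrences set_vars image_image Un_assoc)

lemma free_candidate:
  "i \<in> indices \<phi> \<Longrightarrow> v \<in> atom_vars \<phi> \<Longrightarrow>
   fact_tree free_tag (path_tree i) [enc_var v] \<in> set (candidates k x)"
  unfolding set_candidates by blast

lemma available_candidate:
  assumes "i \<in> indices \<phi>" and "V \<subseteq> atom_vars \<phi>" and "finite V" and "card V \<le> k"
  obtains l where "fact_tree available_tag (path_tree i) l \<in> set (candidates k x)"
    and "set l = enc_var ` V"
proof -
  obtain t where t: "t \<in> set (short_lists k (vars x))" "set (list_of_tree t) = enc_var ` V"
    using short_lists_complete[of "enc_var ` V" "vars x" k] assms by (auto simp: set_vars)
  then have "fact_tree available_tag (path_tree i) (list_of_tree t) \<in> set (candidates k x)"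
    using assms(1) unfolding set_candidates by blast
  then show thesis using that t(2) by blast
qed

lemma excluded_candidate:
  assumes "i \<in> indices \<phi>" and "f \<in> maps B (dom f)" and "dom f \<subseteq> atom_vars \<phi>"
    and "finite (dom f)" and "card (dom f) \<le> k"
  obtains l where "fact_tree excluded_tag (path_tree i) l \<in> set (candidates k x)"
    and "set l = graph_code f"
proof -
  have "graph_code f \<subseteq> set (bindings x)"
    using assms(2,3) by (simp add: graph_code_def set_bindings graph_subset_iff_maps image_mono)
  then obtain t where t: "t \<in> set (short_lists k (bindings x))"
      "set (list_of_tree t) = graph_code f"
    using short_lists_complete[of "graph_code f" "bindings x" k] assms(4,5)
    by (auto simp: finite_graph_code card_graph_code)
  then have "fact_tree excluded_tag (path_tree i) (list_of_tree t) \<in> set (candidates k x)"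
    using assms(1) inj_on_left_graph_code[of f] unfolding set_candidates by force
  then show thesis using that t(2) by blast
qed

lemma candidate_cases:
  assumes "u \<in> set (candidates k x)"
  obtains (free) i v where "i \<in> indices \<phi>" "u = fact_tree free_tag (path_tree i) [enc_var v]"
    | (available) i V l where "i \<in> indices \<phi>" "u = fact_tree available_tag (path_tree i) l"
        "set l = enc_var ` V" "card V \<le> k"
    | (excluded) i f l where "i \<in> indices \<phi>" "u = fact_tree excluded_tag (path_tree i) l"
        "set l = graph_code f" "f \<in> maps B (dom f)" "card (dom f) \<le> k"
proof -
  have card_le: "card X \<le> k" if "t \<in> set (short_lists k L)" "set (list_of_tree t) = X" for t L X
    using that card_length[of "list_of_tree t"] by (simp add: set_short_lists)
  from assms consider (free) i v where "i \<in> indices \<phi>"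
        "u = fact_tree free_tag (path_tree i) [enc_var v]"
    | (available) i t where "i \<in> indices \<phi>" "t \<in> set (short_lists k (vars x))"
        "u = fact_tree available_tag (path_tree i) (list_of_tree t)"
    | (excluded) i t where "i \<in> indices \<phi>" "t \<in> set (short_lists k (bindings x))"
        "inj_on left (set (list_of_tree t))"
        "u = fact_tree excluded_tag (path_tree i) (list_of_tree t)"
    unfolding set_candidates by blast
  then show thesis
  proof cases
    case free
    then show thesis by (rule that(1))
  next
    case available
    then obtain V where V: "set (list_of_tree t) = enc_var ` V"
      using set_vars by (auto simp: set_short_lists subset_image_iff)
    then have "card V \<le> k" using card_le[OF available(2) V] by simp
    then show thesis using that(2) available(1,3) V by blast
  next
    case excluded
    have t: "set (list_of_tree t) \<subseteq> set (bindings x)"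
      using excluded(2) by (simp add: set_short_lists)
    then obtain f where f: "set (list_of_tree t) = graph_code f"
      using inj_on_left_graph_codeE[OF excluded(3)] set_bindings by blast
    then have "f \<in> maps B (dom f)"
      using t inj_image_subset_iff[OF inj_enc_pair[OF inj_enc_var inj_enc_name]]
      by (simp add: set_bindings graph_code_def graph_subset_iff_maps)
    moreover have "card (dom f) \<le> k" using card_le[OF excluded(2) f] by (simp add: card_graph_code)
    ultimately show thesis using that(3) excluded(1,4) f by blast
  qed
qed

lemma saturate_sound: "fact_content ` set (saturate k x) \<subseteq> true_facts k"
proof -
  have "set (saturate k x) \<subseteq> {u. fact_content u \<in> true_facts k}"
    unfolding saturate_def
  proof (rule saturation_sound)
    fix S u assume S: "set S \<subseteq> {u. fact_content u \<in> true_facts k}"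
      and u: "u \<in> set (candidates k x)" and rule: "fact_rule x S u"
    have X: "fact_content ` set S \<subseteq> true_facts k" using S by blast
    from u show "u \<in> {u. fact_content u \<in> true_facts k}"
    proof (cases rule: candidate_cases)
      case (free i v)
      then have "free_at \<phi> i v"
        using rule free_step_sound[OF X] by (simp add: fact_rule_fact_tree free_rule_iff)
      then show ?thesis by (simp add: free(2) fact_content_tree flip: free_fact_def)
    next
      case (available i V l)
      then have "available k \<phi> i V"
        using rule available_step_sound[OF X] by (simp add: fact_rule_fact_tree available_rule_iff)
      then show ?thesis by (simp add: available(2,3) fact_content_tree flip: available_fact_def)
    next
      case (excluded i f l)
      then have "excluded k \<phi> B i f"
        using rule excluded_step_sound[OF X] by (simp add: fact_rule_fact_tree excluded_rule_iff)
      then show ?thesis by (simp add: excluded(2,3) fact_content_tree flip: excluded_fact_def)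
    qed
  qed
  then show ?thesis by blast
qed

definition saturated :: "nat \<Rightarrow> content set" where
  "saturated k = fact_content ` set (saturate k x)"

lemma saturated_closed:
  assumes "fact_tree tag p l \<in> set (candidates k x)"
    and "fact_rule x (saturate k x) (fact_tree tag p l)"
  shows "(tag, p, set l) \<in> saturated k"
proof -
  have "fact_tree tag p l \<in> set (saturate k x)"
    using assms unfolding saturate_def by (rule saturation_closed)
  then show ?thesis
    unfolding saturated_def by (rule image_eqI[rotated]) (simp add: fact_content_tree)
qed

lemma saturated_free:
  assumes "i \<in> indices \<phi>" and "v \<in> atom_vars \<phi>" and "free_step (saturated k) i v"
  shows "free_fact i v \<in> saturated k"
  using saturated_closed[OF free_candidate[OF assms(1,2)]] assms(3)
  by (simp add: fact_rule_fact_tree free_rule_iff[OF assms(1)] free_fact_def saturated_def)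

lemma saturated_available:
  assumes V: "available k \<phi> i V" and "available_step (saturated k) i V"
  shows "available_fact i V \<in> saturated k"
proof -
  have i: "i \<in> indices \<phi>" by (rule availableD(1)[OF V])
  obtain l where l: "fact_tree available_tag (path_tree i) l \<in> set (candidates k x)"
    "set l = enc_var ` V"
    by (rule available_candidate[OF i available_atom_vars[OF V] availableD(4,3)[OF V]])
  then show ?thesis
    using saturated_closed[OF l(1)] assms(2)
    by (simp add: fact_rule_fact_tree available_rule_iff[OF i] available_fact_def saturated_def)
qed

lemma saturated_excluded:
  assumes "excluded k \<phi> B i f" and "excluded_step (saturated k) i f"
  shows "excluded_fact i f \<in> saturated k"
proof -
  have dom: "available k \<phi> i (dom f)" and f: "f \<in> maps B (dom f)"
    using excludedD[OF assms(1)] by blast+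
  have i: "i \<in> indices \<phi>" by (rule availableD(1)[OF dom])
  obtain l where l: "fact_tree excluded_tag (path_tree i) l \<in> set (candidates k x)"
    "set l = graph_code f"
    by (rule excluded_candidate[OF i f available_atom_vars[OF dom] availableD(4,3)[OF dom]])
  then show ?thesis
    using saturated_closed[OF l(1)] assms(2)
    by (simp add: fact_rule_fact_tree excluded_rule_iff[OF i] excluded_fact_def saturated_def)
qed

lemma free_at_saturated: "free_at \<phi> i v \<Longrightarrow> free_fact i v \<in> saturated k"
proof (induction rule: free_at.induct)
  case (free_at_atom i R vs v)
  then show ?case
    using free_at_atom_vars[OF free_at.free_at_atom[OF free_at_atom]]
    by (intro saturated_free) (auto simp: free_step_def)
next
  case (free_at_parent j v i)
  then show ?case
    using free_at_atom_vars[OF free_at.free_at_parent[OF free_at_parent.hyps]] parent_in_indices(1)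
    by (intro saturated_free) (auto simp: free_step_def)
qed

lemma free_subset_saturated:
  "i \<in> indices \<phi> \<Longrightarrow> V \<subseteq> free (subf \<phi> i) \<Longrightarrow> \<forall>v\<in>V. free_fact i v \<in> saturated k"
  using free_at_saturated free_at_iff by blast

lemma available_saturated: "available k \<phi> i V \<Longrightarrow> available_fact i V \<in> saturated k"
proof (induction rule: available.induct)
  case (available_atom i R vs)
  then show ?case
    by (intro saturated_available available.available_atom) (auto simp: available_step_def)
next
  case (available_projection i y V)
  have "y \<in> atom_vars \<phi>" using available_atom_vars[OF available_projection.hyps] by simp
  then have "available_step (saturated k) i V"
    using available_projection.IH unfolding available_step_def by blast
  then show ?case
    using available_projection.hyps available.available_projection saturated_available by blast
next
  case (available_join i V y)
  show ?case
  proof (cases "y \<in> V")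
    case True
    then show ?thesis using available_join.IH(1) by (simp add: insert_absorb)
  next
    case False
    then have "available_step (saturated k) i (insert y V)"
      using available_join.IH unfolding available_step_def by (metis Diff_insert_absorb insertI1)
    then show ?thesis
      using available_join.hyps available.available_join saturated_available by blast
  qed
next
  case (available_flow j V i)
  then have "i \<in> indices \<phi>" using parent_in_indices by blast
  then have "available_step (saturated k) i V"
    using available_flow free_subset_saturated unfolding available_step_def by blast
  then show ?case
    using available_flow.hyps available.available_flow saturated_available by blast
qed

lemma excluded_saturated: "excluded k \<phi> B i f \<Longrightarrow> excluded_fact i f \<in> saturated k"
proof (induction rule: excluded.induct)
  case (excluded_atom i R vs f)
  then have "excluded_step (saturated k) i f"
    using maps_dom unfolding excluded_step_def by blast
  then show ?case
    using excluded.excluded_atom[OF excluded_atom] saturated_excluded by blast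
next
  case (excluded_projection i y f)
  have "y \<in> atom_vars \<phi>" using available_atom_vars[OF excluded_projection.hyps(1)] by simp
  then have "excluded_step (saturated k) i f"
    using excluded_projection available_saturated unfolding excluded_step_def by blast
  then show ?case
    using excluded_projection excluded.excluded_projection saturated_excluded by blast
next
  case (excluded_join i f y b)
  have "(f(y \<mapsto> b))(y := None) = f" using excluded_join.hyps(3) by auto
  moreover have "available_fact i (dom (f(y \<mapsto> b))) \<in> saturated k"
    using available_saturated[OF excluded_join.hyps(2)] by simp
  ultimately have "excluded_step (saturated k) i (f(y \<mapsto> b))"
    using excluded_join.IH unfolding excluded_step_def by (metis domI fun_upd_same)
  then show ?case
    using excluded.excluded_join[OF excluded_join.hyps] saturated_excluded by blast
next
  case (excluded_flow j f i)
  then have "i \<in> indices \<phi>" using parent_in_indices by blast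
  then have "excluded_step (saturated k) i f"
    using excluded_flow free_subset_saturated unfolding excluded_step_def by blast
  then show ?case
    using excluded.excluded_flow[OF excluded_flow.hyps] saturated_excluded by blast
next
  case (excluded_forall_elim j f y b i)
  have "b \<in> univ B (sort_of y)"
    using excludedD(2)[OF excluded_forall_elim.hyps(1)]
      maps_upd_iff[OF excluded_forall_elim.hyps(2), of b B]
    by (simp del: fun_upd_apply)
  then have "excluded_step (saturated k) i f"
    using excluded_forall_elim unfolding excluded_step_def by blast
  then show ?case
    using excluded.excluded_forall_elim[OF excluded_forall_elim.hyps] saturated_excluded by blast
qed

lemma judge_consistent_iff_saturate:
  "judge_consistent k \<phi> B \<longleftrightarrow> \<not> known (saturate k x) excluded_tag Leaf []"
proof -
  have "excluded k \<phi> B [] Map.empty \<longleftrightarrow> excluded_fact [] Map.empty \<in> saturated k"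
    using excluded_saturated saturate_sound unfolding saturated_def
    by (metis subsetD true_facts_iff(3))
  also have "\<dots> \<longleftrightarrow> known (saturate k x) excluded_tag Leaf []"
    by (simp add: saturated_def known_def excluded_fact_def)
  finally show ?thesis
    using judge_consistent_iff_not_excluded[OF inst finite] by blast
qed

end

theorem theorem5p4:
  fixes k :: nat
  assumes "k \<ge> 1"
  shows "\<exists>(c :: prog) (p :: nat poly).
    \<forall>(\<phi> :: (name, name, name) qc) (B :: (name, name, name) struct) (x :: tree).
      qcsp_instance \<phi> B \<and> finite_struct B \<and> encodes_instance x \<phi> B \<longrightarrow>
      outputs_within c x (poly p (tsize x)) (enc_bool (judge_consistent k \<phi> B))"
proof -
  have "poly_time_pred (\<lambda>x. \<not> known (saturate k x) excluded_tag Leaf [])"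
    by (intro poly_time_pred_not poly_time_pred_known poly_time_list_saturate poly_time_intros)
  then obtain c p where outputs:
    "\<And>x. outputs_within c x (poly p (tsize x))
      (enc_bool (\<not> known (saturate k x) excluded_tag Leaf []))"
    unfolding poly_time_pred_def using poly_time_outputs_within by blast
  have "outputs_within c x (poly p (tsize x)) (enc_bool (judge_consistent k \<phi> B))"
    if inst: "qcsp_instance \<phi> B \<and> finite_struct B \<and> encodes_instance x \<phi> B" for \<phi> B x
  proof -
    obtain us rs where "encoded_instance \<phi> B us rs x"
      using inst unfolding encodes_instance_def encoded_instance_def by blast
    then show ?thesis
      using outputs[of x] encoded_instance.judge_consistent_iff_saturate by simp
  qed
  then show ?thesis by blast
qed

end
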